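(* Let $\mathcal{T}$ be a triangulated category with suspension functor $\Sigma$, and let $\mathcal{A}\subseteq\mathcal{T}$ be an extension closed proper abelian subcategory. Assume that $\mathcal{T}$ is Krull-Schmidt and that $\mathcal{T}(\mathcal{A},\Sigma^{-i}\mathcal{A})=0$ for $i=1,2$. Let $F:\Sigma\mathcal{A}\ast\mathcal{A}\to\mathcal{A}$ be the functor such that $\Sigma F(c)\to c$ is the minimal right $\Sigma\mathcal{A}$-approximation of $c$. (1) If $\mathcal{F}\subseteq\mathcal{A}$ is a torsion-free class, then $\Sigma\mathcal{F}\ast\mathcal{A}$ is an $\mathcal{A}$-intermediate category. Furthermore, $F(\Sigma\mathcal{F}\ast\mathcal{A})=\mathcal{F}$. (2) Let $\mathcal{C}$ be an $\mathcal{A}$-intermediate category which also satisfies $\mathcal{C}\subseteq\mathcal{A}\ast\Sigma\mathcal{A}$. Then $F(\mathcal{C})$ is a torsion-free class in $\mathcal{A}$. Furthermore, $\mathcal{C}=\Sigma F(\mathcal{C})\ast\mathcal{A}$. If $\mathcal{A}\ast\Sigma\mathcal{A}=\Sigma\mathcal{A}\ast\mathcal{A}$, this gives a bijection between the collection of $\mathcal{A}$-intermediate categories in $\mathcal{T}$ and the collection of torsion-free classes of $\mathcal{A}$, given by $\mathcal{C}\mapsto F(\mathcal{C})$ with inverse $\mathcal{F}\mapsto\Sigma\mathcal{F}\ast\mathcal{A}$.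
   Context: All subcategories are full. "Triangle" means distinguished triangle. $\mathcal{T}(x,y)$ denotes $\mathrm{Hom}_{\mathcal{T}}(x,y)$, and $\mathcal{T}(\mathcal{X},\mathcal{Y})=0$ means $\mathcal{T}(x,y)=0$ for all $x\in\mathcal{X}$, $y\in\mathcal{Y}$. An additive subcategory is a subcategory closed under isomorphisms, direct sums and direct summands. An additive subcategory $\mathcal{A}\subseteq\mathcal{T}$ is a proper abelian subcategory if it is abelian in such a way that $a\xrightarrow{\alpha}a'\xrightarrow{\alpha'}a''$ is a short exact sequence in $\mathcal{A}$ if and only if there is a triangle $a\xrightarrow{\alpha}a'\xrightarrow{\alpha'}a''\to\Sigma a$ in $\mathcal{T}$. For subcategories $\mathcal{X},\mathcal{Y}\subseteq\mathcal{T}$, $\mathcal{X}\ast\mathcal{Y}$ is the subcategory of objects $z$ for which there is a triangle $x\to z\to y\to\Sigma x$ in $\mathcal{T}$ with $x\in\mathcal{X}$, $y\in\mathcal{Y}$. A subcategory $\mathcal{X}\subseteq\mathcal{T}$ is extension closed if $\mathcal{X}\ast\mathcal{X}\subseteq\mathcal{X}$. A torsion-free class in an abelian category $\mathcal{A}$ is an additive subcategory $\mathcal{F}\subseteq\mathcal{A}$ closed under extensions and subobjects. A subcategory $\mathcal{C}\subseteq\mathcal{T}$ is $\mathcal{A}$-intermediate if $\mathcal{A}\subseteq\mathcal{C}\subseteq\Sigma\mathcal{A}\ast\mathcal{A}$, $\mathcal{C}$ is extension closed in $\mathcal{T}$, and $\mathcal{C}$ is closed under direct summands. A right $\mathcal{X}$-approximation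 of $c$ is a morphism $\phi:x\to c$ with $x\in\mathcal{X}$ through which every morphism $x'\to c$ with $x'\in\mathcal{X}$ factors; it is minimal if every endomorphism $e$ of $x$ with $\phi e=\phi$ is an isomorphism. Under the hypotheses, every $c\in\Sigma\mathcal{A}\ast\mathcal{A}$ has a minimal right $\Sigma\mathcal{A}$-approximation $\phi_c:\Sigma F(c)\to c$ with $F(c)\in\mathcal{A}$, unique up to isomorphism, and for $f:c\to c'$ the morphism $F(f)$ is the unique one with $\phi_{c'}\circ\Sigma F(f)=f\circ\phi_c$; this defines the functor $F$. For a subcategory $\mathcal{C}\subseteq\Sigma\mathcal{A}\ast\mathcal{A}$, $F(\mathcal{C})$ denotes the full subcategory of $\mathcal{A}$ of objects isomorphic to $F(c)$ for some $c\in\mathcal{C}$. *)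

theory Defs
  imports "HOL-Algebra.Ring"
begin

text \<open>
  \<open>Comp C g f\<close>, written \<open>g \<cdot>\<^bsub>C\<^esub> f\<close>, is "first \<open>f\<close>, then \<open>g\<close>".
\<close>

record ('o, 'm) cat_data =
  Obj  :: "'o set"
  Arr  :: "'m set"
  Dom  :: "'m \<Rightarrow> 'o"
  Cod  :: "'m \<Rightarrow> 'o"
  Id   :: "'o \<Rightarrow> 'm"
  Comp :: "'m \<Rightarrow> 'm \<Rightarrow> 'm" (infixl "\<cdot>\<index>" 70)
  Add  :: "'m \<Rightarrow> 'm \<Rightarrow> 'm"
  Zer  :: "'o \<Rightarrow> 'o \<Rightarrow> 'm"

definition Hom :: "('o, 'm, 'z) cat_data_scheme \<Rightarrow> 'o \<Rightarrow> 'o \<Rightarrow> 'm set" where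
  "Hom C x y = {f \<in> Arr C. Dom C f = x \<and> Cod C f = y}"

definition Hom_group :: "('o, 'm, 'z) cat_data_scheme \<Rightarrow> 'o \<Rightarrow> 'o \<Rightarrow> 'm monoid" where
  "Hom_group C x y = \<lparr>carrier = Hom C x y, mult = Add C, one = Zer C x y\<rparr>"

definition Neg :: "('o, 'm, 'z) cat_data_scheme \<Rightarrow> 'm \<Rightarrow> 'm" where
  "Neg C f = inv\<^bsub>Hom_group C (Dom C f) (Cod C f)\<^esub> f"

definition End_ring :: "('o, 'm, 'z) cat_data_scheme \<Rightarrow> 'o \<Rightarrow> 'm ring" where
  "End_ring C x = \<lparr>carrier = Hom C x x, mult = Comp C, one = Id C x, zero = Zer C x x, add = Add C\<rparr>"

locale category =
  fixes C :: "('o, 'm, 'z) cat_data_scheme" (structure)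
  assumes arr_typed: "f \<in> Arr C \<Longrightarrow> Dom C f \<in> Obj C \<and> Cod C f \<in> Obj C"
    and id_in_Hom: "x \<in> Obj C \<Longrightarrow> Id C x \<in> Hom C x x"
    and comp_in_Hom: "\<lbrakk>f \<in> Hom C x y; g \<in> Hom C y z\<rbrakk> \<Longrightarrow> g \<cdot> f \<in> Hom C x z"
    and comp_assoc: "\<lbrakk>f \<in> Hom C w x; g \<in> Hom C x y; h \<in> Hom C y z\<rbrakk> \<Longrightarrow> (h \<cdot> g) \<cdot> f = h \<cdot> (g \<cdot> f)"
    and comp_id_right: "f \<in> Hom C x y \<Longrightarrow> f \<cdot> Id C x = f"
    and comp_id_left: "f \<in> Hom C x y \<Longrightarrow> Id C y \<cdot> f = f"

locale preadditive_category = category +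
  assumes Hom_comm_group: "\<lbrakk>x \<in> Obj C; y \<in> Obj C\<rbrakk> \<Longrightarrow> comm_group (Hom_group C x y)"
    and comp_add_left: "\<lbrakk>f \<in> Hom C x y; g \<in> Hom C y z; h \<in> Hom C y z\<rbrakk>
          \<Longrightarrow> Add C g h \<cdot> f = Add C (g \<cdot> f) (h \<cdot> f)"
    and comp_add_right: "\<lbrakk>f \<in> Hom C x y; g \<in> Hom C x y; h \<in> Hom C y z\<rbrakk>
          \<Longrightarrow> h \<cdot> Add C f g = Add C (h \<cdot> f) (h \<cdot> g)"

definition is_iso :: "('o, 'm, 'z) cat_data_scheme \<Rightarrow> 'm \<Rightarrow> bool" where
  "is_iso C f \<longleftrightarrow> f \<in> Arr C \<and>
     (\<exists>g \<in> Hom C (Cod C f) (Dom C f). g \<cdot>\<^bsub>C\<^esub> f = Id C (Dom C f) \<and> f \<cdot>\<^bsub>C\<^esub> g = Id C (Cod C f))"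

definition isomorphic :: "('o, 'm, 'z) cat_data_scheme \<Rightarrow> 'o \<Rightarrow> 'o \<Rightarrow> bool" where
  "isomorphic C x y \<longleftrightarrow> (\<exists>f \<in> Hom C x y. is_iso C f)"

definition zero_object :: "('o, 'm, 'z) cat_data_scheme \<Rightarrow> 'o \<Rightarrow> bool" where
  "zero_object C x \<longleftrightarrow> x \<in> Obj C \<and>
     (\<forall>y \<in> Obj C. (\<exists>!f. f \<in> Hom C x y) \<and> (\<exists>!f. f \<in> Hom C y x))"

definition direct_sum :: "('o, 'm, 'z) cat_data_scheme \<Rightarrow> 'o \<Rightarrow> 'o \<Rightarrow> 'o \<Rightarrow> bool" where
  "direct_sum C z x y \<longleftrightarrow> x \<in> Obj C \<and> y \<in> Obj C \<and> z \<in> Obj C \<and>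
     (\<exists>i \<in> Hom C x z. \<exists>j \<in> Hom C y z. \<exists>p \<in> Hom C z x. \<exists>q \<in> Hom C z y.
        p \<cdot>\<^bsub>C\<^esub> i = Id C x \<and> q \<cdot>\<^bsub>C\<^esub> j = Id C y \<and> p \<cdot>\<^bsub>C\<^esub> j = Zer C y x \<and> q \<cdot>\<^bsub>C\<^esub> i = Zer C x y \<and>
        Add C (i \<cdot>\<^bsub>C\<^esub> p) (j \<cdot>\<^bsub>C\<^esub> q) = Id C z)"

locale additive_category = preadditive_category +
  assumes ex_zero_object: "\<exists>x. zero_object C x"
    and ex_direct_sum: "\<lbrakk>x \<in> Obj C; y \<in> Obj C\<rbrakk> \<Longrightarrow> \<exists>z. direct_sum C z x y"

inductive_set finite_sums :: "('o, 'm, 'z) cat_data_scheme \<Rightarrow> 'o set \<Rightarrow> 'o set"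
  for C :: "('o, 'm, 'z) cat_data_scheme" and X :: "'o set" where
  empty: "zero_object C z \<Longrightarrow> z \<in> finite_sums C X"
| insert: "\<lbrakk>x \<in> X; y \<in> finite_sums C X; direct_sum C z x y\<rbrakk> \<Longrightarrow> z \<in> finite_sums C X"

definition local_ring :: "('r, 'z) ring_scheme \<Rightarrow> bool" where
  "local_ring R \<longleftrightarrow> ring R \<and> \<one>\<^bsub>R\<^esub> \<noteq> \<zero>\<^bsub>R\<^esub> \<and>
     (\<forall>a \<in> carrier R - Units R. \<forall>b \<in> carrier R - Units R. a \<oplus>\<^bsub>R\<^esub> b \<notin> Units R)"

definition krull_schmidt :: "('o, 'm, 'z) cat_data_scheme \<Rightarrow> bool" where
  "krull_schmidt C \<longleftrightarrow> additive_category C \<and>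
     Obj C \<subseteq> finite_sums C {x \<in> Obj C. local_ring (End_ring C x)}"

text \<open>A full subcategory of a category is represented by its set of objects.\<close>

definition full_subcat :: "('o, 'm, 'z) cat_data_scheme \<Rightarrow> 'o set \<Rightarrow> ('o, 'm) cat_data" where
  "full_subcat C X = \<lparr>Obj = X, Arr = {f \<in> Arr C. Dom C f \<in> X \<and> Cod C f \<in> X},
     Dom = Dom C, Cod = Cod C, Id = Id C, Comp = Comp C, Add = Add C, Zer = Zer C\<rparr>"

definition summand_closed :: "('o, 'm, 'z) cat_data_scheme \<Rightarrow> 'o set \<Rightarrow> bool" where
  "summand_closed C X \<longleftrightarrow> (\<forall>z \<in> X. \<forall>x y. direct_sum C z x y \<longrightarrow> x \<in> X \<and> y \<in> X)"

text \<open>The zero objects are the empty direct sums.\<close>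

definition additive_subcategory :: "('o, 'm, 'z) cat_data_scheme \<Rightarrow> 'o set \<Rightarrow> bool" where
  "additive_subcategory C X \<longleftrightarrow> X \<subseteq> Obj C \<and>
     (\<forall>x \<in> X. \<forall>y \<in> Obj C. isomorphic C x y \<longrightarrow> y \<in> X) \<and>
     (\<forall>z. zero_object C z \<longrightarrow> z \<in> X) \<and>
     (\<forall>x \<in> X. \<forall>y \<in> X. \<forall>z. direct_sum C z x y \<longrightarrow> z \<in> X) \<and>
     summand_closed C X"

definition monic :: "('o, 'm, 'z) cat_data_scheme \<Rightarrow> 'm \<Rightarrow> bool" where
  "monic C f \<longleftrightarrow> f \<in> Arr C \<and>
     (\<forall>w. \<forall>g \<in> Hom C w (Dom C f). \<forall>h \<in> Hom C w (Dom C f). f \<cdot>\<^bsub>C\<^esub> g = f \<cdot>\<^bsub>C\<^esub> h \<longrightarrow> g = h)"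

definition epic :: "('o, 'm, 'z) cat_data_scheme \<Rightarrow> 'm \<Rightarrow> bool" where
  "epic C f \<longleftrightarrow> f \<in> Arr C \<and>
     (\<forall>w. \<forall>g \<in> Hom C (Cod C f) w. \<forall>h \<in> Hom C (Cod C f) w. g \<cdot>\<^bsub>C\<^esub> f = h \<cdot>\<^bsub>C\<^esub> f \<longrightarrow> g = h)"

definition is_kernel :: "('o, 'm, 'z) cat_data_scheme \<Rightarrow> 'm \<Rightarrow> 'm \<Rightarrow> bool" where
  "is_kernel C k f \<longleftrightarrow> f \<in> Arr C \<and> k \<in> Arr C \<and> Cod C k = Dom C f \<and>
     f \<cdot>\<^bsub>C\<^esub> k = Zer C (Dom C k) (Cod C f) \<and>
     (\<forall>w. \<forall>t \<in> Hom C w (Dom C f). f \<cdot>\<^bsub>C\<^esub> t = Zer C w (Cod C f) \<longrightarrow>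
        (\<exists>!s. s \<in> Hom C w (Dom C k) \<and> k \<cdot>\<^bsub>C\<^esub> s = t))"

definition is_cokernel :: "('o, 'm, 'z) cat_data_scheme \<Rightarrow> 'm \<Rightarrow> 'm \<Rightarrow> bool" where
  "is_cokernel C q f \<longleftrightarrow> f \<in> Arr C \<and> q \<in> Arr C \<and> Dom C q = Cod C f \<and>
     q \<cdot>\<^bsub>C\<^esub> f = Zer C (Dom C f) (Cod C q) \<and>
     (\<forall>w. \<forall>t \<in> Hom C (Cod C f) w. t \<cdot>\<^bsub>C\<^esub> f = Zer C (Dom C f) w \<longrightarrow>
        (\<exists>!s. s \<in> Hom C (Cod C q) w \<and> s \<cdot>\<^bsub>C\<^esub> q = t))"

locale abelian_category = additive_category +
  assumes ex_kernel: "f \<in> Arr C \<Longrightarrow> \<exists>k. is_kernel C k f"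
    and ex_cokernel: "f \<in> Arr C \<Longrightarrow> \<exists>q. is_cokernel C q f"
    and monic_is_kernel: "monic C f \<Longrightarrow> \<exists>g. is_kernel C f g"
    and epic_is_cokernel: "epic C f \<Longrightarrow> \<exists>g. is_cokernel C f g"

definition short_exact :: "('o, 'm, 'z) cat_data_scheme \<Rightarrow> 'm \<Rightarrow> 'm \<Rightarrow> bool" where
  "short_exact C f g \<longleftrightarrow> is_kernel C f g \<and> is_cokernel C g f"

definition torsion_free_class :: "('o, 'm, 'z) cat_data_scheme \<Rightarrow> 'o set \<Rightarrow> bool" where
  "torsion_free_class C \<F> \<longleftrightarrow> additive_subcategory C \<F> \<and>
     (\<forall>f g. short_exact C f g \<and> Dom C f \<in> \<F> \<and> Cod C g \<in> \<F> \<longrightarrow> Cod C f \<in> \<F>) \<and>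
     (\<forall>m. monic C m \<and> Cod C m \<in> \<F> \<longrightarrow> Dom C m \<in> \<F>)"

definition is_functor ::
  "('o, 'm, 'z) cat_data_scheme \<Rightarrow> ('p, 'n, 'w) cat_data_scheme \<Rightarrow> ('o \<Rightarrow> 'p) \<Rightarrow> ('m \<Rightarrow> 'n) \<Rightarrow> bool" where
  "is_functor C D Fo Fm \<longleftrightarrow>
     (\<forall>x \<in> Obj C. Fo x \<in> Obj D \<and> Fm (Id C x) = Id D (Fo x)) \<and>
     (\<forall>x y. \<forall>f \<in> Hom C x y. Fm f \<in> Hom D (Fo x) (Fo y)) \<and>
     (\<forall>x y z. \<forall>f \<in> Hom C x y. \<forall>g \<in> Hom C y z. Fm (g \<cdot>\<^bsub>C\<^esub> f) = Fm g \<cdot>\<^bsub>D\<^esub> Fm f)"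

record ('o, 'm) tri_data = "('o, 'm) cat_data" +
  SObj :: "'o \<Rightarrow> 'o"
  SArr :: "'m \<Rightarrow> 'm"
  Tri  :: "('m \<times> 'm \<times> 'm) set"

text \<open>\<open>triangle T x y z u v w\<close>: the diagram \<open>x \<rightarrow> y \<rightarrow> z \<rightarrow> \<Sigma>x\<close> with maps \<open>u\<close>, \<open>v\<close>, \<open>w\<close> is distinguished.\<close>

definition triangle ::
  "('o, 'm, 'z) tri_data_scheme \<Rightarrow> 'o \<Rightarrow> 'o \<Rightarrow> 'o \<Rightarrow> 'm \<Rightarrow> 'm \<Rightarrow> 'm \<Rightarrow> bool" where
  "triangle T x y z u v w \<longleftrightarrow>
     u \<in> Hom T x y \<and> v \<in> Hom T y z \<and> w \<in> Hom T z (SObj T x) \<and> (u, v, w) \<in> Tri T"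

text \<open>
  The suspension is an additive auto-equivalence (fully faithful and essentially surjective);
  it need not be bijective on objects. The octahedral axiom is included.
\<close>

locale triangulated_category = additive_category T
  for T :: "('o, 'm, 'z) tri_data_scheme" (structure) +
  assumes susp_functor: "is_functor T T (SObj T) (SArr T)"
    and susp_additive: "\<lbrakk>f \<in> Hom T x y; g \<in> Hom T x y\<rbrakk>
          \<Longrightarrow> SArr T (Add T f g) = Add T (SArr T f) (SArr T g)"
    and susp_fully_faithful: "\<lbrakk>x \<in> Obj T; y \<in> Obj T\<rbrakk>
          \<Longrightarrow> bij_betw (SArr T) (Hom T x y) (Hom T (SObj T x) (SObj T y))"
    and susp_ess_surj: "y \<in> Obj T \<Longrightarrow> \<exists>x \<in> Obj T. isomorphic T (SObj T x) y"
    and TR1_id: "\<lbrakk>x \<in> Obj T; zero_object T z\<rbrakk>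
          \<Longrightarrow> triangle T x x z (Id T x) (Zer T x z) (Zer T z (SObj T x))"
    and TR1_ex: "u \<in> Hom T x y \<Longrightarrow> \<exists>z v w. triangle T x y z u v w"
    and TR1_iso: "\<lbrakk>triangle T x y z u v w;
          u' \<in> Hom T x' y'; v' \<in> Hom T y' z'; w' \<in> Hom T z' (SObj T x');
          f \<in> Hom T x x'; g \<in> Hom T y y'; h \<in> Hom T z z';
          is_iso T f; is_iso T g; is_iso T h;
          g \<cdot> u = u' \<cdot> f; h \<cdot> v = v' \<cdot> g; SArr T f \<cdot> w = w' \<cdot> h\<rbrakk>
          \<Longrightarrow> triangle T x' y' z' u' v' w'"
    and TR2: "\<lbrakk>u \<in> Hom T x y; v \<in> Hom T y z; w \<in> Hom T z (SObj T x)\<rbrakk>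
          \<Longrightarrow> triangle T x y z u v w \<longleftrightarrow> triangle T y z (SObj T x) v w (Neg T (SArr T u))"
    and TR3: "\<lbrakk>triangle T x y z u v w; triangle T x' y' z' u' v' w';
          f \<in> Hom T x x'; g \<in> Hom T y y'; g \<cdot> u = u' \<cdot> f\<rbrakk>
          \<Longrightarrow> \<exists>h \<in> Hom T z z'. h \<cdot> v = v' \<cdot> g \<and> SArr T f \<cdot> w = w' \<cdot> h"
    and TR4: "\<lbrakk>triangle T x y z' u i i'; triangle T y z x' v j j'; triangle T x z y' (v \<cdot> u) k k'\<rbrakk>
          \<Longrightarrow> \<exists>f g. triangle T z' y' x' f g (SArr T i \<cdot> j') \<and>
                f \<cdot> i = k \<cdot> v \<and> k' \<cdot> f = i' \<and> g \<cdot> k = j \<and> j' \<cdot> g = SArr T u \<cdot> k'"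

text \<open>
  \<open>\<Sigma>X\<close> and \<open>\<Sigma>\<^sup>-\<^sup>iX\<close> as full subcategories closed under isomorphisms. Since \<open>\<Sigma>\<close> is an
  auto-equivalence, the objects \<open>\<Sigma>\<^sup>-\<^sup>ix\<close> are, up to isomorphism, the \<open>z\<close> with \<open>\<Sigma>\<^sup>iz \<cong> x\<close>.
\<close>

definition susp :: "('o, 'm, 'z) tri_data_scheme \<Rightarrow> 'o set \<Rightarrow> 'o set" where
  "susp T X = {z \<in> Obj T. \<exists>x \<in> X. isomorphic T z (SObj T x)}"

definition desusp :: "('o, 'm, 'z) tri_data_scheme \<Rightarrow> nat \<Rightarrow> 'o set \<Rightarrow> 'o set" where
  "desusp T i X = {z \<in> Obj T. \<exists>x \<in> X. isomorphic T ((SObj T ^^ i) z) x}"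

definition Hom_vanishes :: "('o, 'm, 'z) cat_data_scheme \<Rightarrow> 'o set \<Rightarrow> 'o set \<Rightarrow> bool" where
  "Hom_vanishes C X Y \<longleftrightarrow> (\<forall>x \<in> X. \<forall>y \<in> Y. Hom C x y = {Zer C x y})"

definition star :: "('o, 'm, 'z) tri_data_scheme \<Rightarrow> 'o set \<Rightarrow> 'o set \<Rightarrow> 'o set" where
  "star T X Y = {z \<in> Obj T. \<exists>x \<in> X. \<exists>y \<in> Y. \<exists>u v w. triangle T x z y u v w}"

definition extension_closed :: "('o, 'm, 'z) tri_data_scheme \<Rightarrow> 'o set \<Rightarrow> bool" where
  "extension_closed T X \<longleftrightarrow> star T X X \<subseteq> X"

definition proper_abelian_subcategory :: "('o, 'm, 'z) tri_data_scheme \<Rightarrow> 'o set \<Rightarrow> bool" where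
  "proper_abelian_subcategory T \<A> \<longleftrightarrow> additive_subcategory T \<A> \<and> abelian_category (full_subcat T \<A>) \<and>
     (\<forall>a \<in> \<A>. \<forall>a' \<in> \<A>. \<forall>a'' \<in> \<A>. \<forall>f \<in> Hom T a a'. \<forall>g \<in> Hom T a' a''.
        short_exact (full_subcat T \<A>) f g \<longleftrightarrow> (\<exists>h. triangle T a a' a'' f g h))"

definition intermediate :: "('o, 'm, 'z) tri_data_scheme \<Rightarrow> 'o set \<Rightarrow> 'o set \<Rightarrow> bool" where
  "intermediate T \<A> \<C> \<longleftrightarrow> \<A> \<subseteq> \<C> \<and> \<C> \<subseteq> star T (susp T \<A>) \<A> \<and>
     extension_closed T \<C> \<and> summand_closed T \<C>"

definition right_approximation ::
  "('o, 'm, 'z) cat_data_scheme \<Rightarrow> 'o set \<Rightarrow> 'o \<Rightarrow> 'o \<Rightarrow> 'm \<Rightarrow> bool" where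
  "right_approximation C X c x \<phi> \<longleftrightarrow> x \<in> X \<and> \<phi> \<in> Hom C x c \<and>
     (\<forall>x' \<in> X. \<forall>f \<in> Hom C x' c. \<exists>g \<in> Hom C x' x. \<phi> \<cdot>\<^bsub>C\<^esub> g = f)"

definition minimal_right_approximation ::
  "('o, 'm, 'z) cat_data_scheme \<Rightarrow> 'o set \<Rightarrow> 'o \<Rightarrow> 'o \<Rightarrow> 'm \<Rightarrow> bool" where
  "minimal_right_approximation C X c x \<phi> \<longleftrightarrow> right_approximation C X c x \<phi> \<and>
     (\<forall>e \<in> Hom C x x. \<phi> \<cdot>\<^bsub>C\<^esub> e = \<phi> \<longrightarrow> is_iso C e)"

text \<open>
  \<open>(Fo, Fm)\<close> is a functor \<open>F : \<Sigma>\<A> * \<A> \<rightarrow> \<A>\<close> and \<open>\<phi> c : \<Sigma>F(c) \<rightarrow> c\<close> are minimal right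
  \<open>\<Sigma>\<A>\<close>-approximations, natural in \<open>c\<close>.
\<close>

definition approximation_functor ::
  "('o, 'm, 'z) tri_data_scheme \<Rightarrow> 'o set \<Rightarrow> ('o \<Rightarrow> 'o) \<Rightarrow> ('m \<Rightarrow> 'm) \<Rightarrow> ('o \<Rightarrow> 'm) \<Rightarrow> bool" where
  "approximation_functor T \<A> Fo Fm \<phi> \<longleftrightarrow>
     is_functor (full_subcat T (star T (susp T \<A>) \<A>)) (full_subcat T \<A>) Fo Fm \<and>
     (\<forall>c \<in> star T (susp T \<A>) \<A>.
        minimal_right_approximation T (susp T \<A>) c (SObj T (Fo c)) (\<phi> c)) \<and>
     (\<forall>c \<in> star T (susp T \<A>) \<A>. \<forall>c' \<in> star T (susp T \<A>) \<A>. \<forall>f \<in> Hom T c c'.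
        \<phi> c' \<cdot>\<^bsub>T\<^esub> SArr T (Fm f) = f \<cdot>\<^bsub>T\<^esub> \<phi> c)"

definition functor_image ::
  "('o, 'm, 'z) cat_data_scheme \<Rightarrow> 'o set \<Rightarrow> ('o \<Rightarrow> 'o) \<Rightarrow> 'o set \<Rightarrow> 'o set" where
  "functor_image T \<A> Fo \<C> = {a \<in> \<A>. \<exists>c \<in> \<C>. isomorphic T a (Fo c)}"

lemma HomD: "f \<in> Hom C x y \<Longrightarrow> f \<in> Arr C \<and> Dom C f = x \<and> Cod C f = y"
  by (simp add: Hom_def)

lemma (in category) Hom_obj: "f \<in> Hom C x y \<Longrightarrow> x \<in> Obj C \<and> y \<in> Obj C"
  using arr_typed by (auto simp: Hom_def)

context preadditive_category
begin

lemma Hom_group_simps [simp]: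
  "carrier (Hom_group C x y) = Hom C x y" "mult (Hom_group C x y) = Add C"
  "one (Hom_group C x y) = Zer C x y"
  by (simp_all add: Hom_group_def)

lemma Hom_grp: "\<lbrakk>x \<in> Obj C; y \<in> Obj C\<rbrakk> \<Longrightarrow> group (Hom_group C x y)"
  using Hom_comm_group by (simp add: comm_group_def)

lemma zer_in: "\<lbrakk>x \<in> Obj C; y \<in> Obj C\<rbrakk> \<Longrightarrow> Zer C x y \<in> Hom C x y"
  using Hom_grp[of x y, THEN group.is_monoid, THEN monoid.one_closed] by simp

lemma add_in: "\<lbrakk>f \<in> Hom C x y; g \<in> Hom C x y\<rbrakk> \<Longrightarrow> Add C f g \<in> Hom C x y"
  using Hom_grp[of x y, THEN group.is_monoid, THEN monoid.m_closed, of f g] Hom_obj by simp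

lemma neg_in: "f \<in> Hom C x y \<Longrightarrow> Neg C f \<in> Hom C x y"
  using Hom_grp[of x y, THEN group.inv_closed, of f] Hom_obj[of f x y] HomD[of f C x y]
  by (simp add: Neg_def)

lemma add_neg: "f \<in> Hom C x y \<Longrightarrow> Add C f (Neg C f) = Zer C x y"
  using Hom_grp[of x y, THEN group.r_inv, of f] Hom_obj[of f x y] HomD[of f C x y]
  by (simp add: Neg_def)

lemma add_eq_zer: "\<lbrakk>f \<in> Hom C x y; g \<in> Hom C x y; Add C f g = Zer C x y\<rbrakk> \<Longrightarrow> f = Neg C g"
  using Hom_grp[of x y, THEN group.inv_equality, of f g] Hom_obj[of f x y] HomD[of g C x y]
  by (simp add: Neg_def)

lemma add_idem: "\<lbrakk>f \<in> Hom C x y; Add C f f = f\<rbrakk> \<Longrightarrow> f = Zer C x y"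
  using Hom_grp[of x y, THEN group.is_monoid]
    Hom_grp[of x y, THEN group.l_cancel_one, of f f] Hom_obj[of f x y]
  by simp

lemma neg_neg: "f \<in> Hom C x y \<Longrightarrow> Neg C (Neg C f) = f"
  using add_eq_zer[OF _ neg_in add_neg] by metis

lemma zer_add_zer: "\<lbrakk>x \<in> Obj C; y \<in> Obj C\<rbrakk> \<Longrightarrow> Add C (Zer C x y) (Zer C x y) = Zer C x y"
  using Hom_grp[of x y, THEN group.is_monoid, THEN monoid.l_one, of "Zer C x y"] zer_in by simp

lemma comp_zer: assumes h: "h \<in> Hom C y z" and x: "x \<in> Obj C"
  shows "h \<cdot> Zer C x y = Zer C x z"
proof -
  have y: "y \<in> Obj C" using Hom_obj[OF h] by simp
  have "h \<cdot> Zer C x y = Add C (h \<cdot> Zer C x y) (h \<cdot> Zer C x y)"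
    using comp_add_right[OF zer_in[OF x y] zer_in[OF x y] h] zer_add_zer[OF x y] by simp
  then show ?thesis using add_idem[OF comp_in_Hom[OF zer_in[OF x y] h]] by simp
qed

lemma zer_comp: assumes f: "f \<in> Hom C x y" and z: "z \<in> Obj C"
  shows "Zer C y z \<cdot> f = Zer C x z"
proof -
  have y: "y \<in> Obj C" using Hom_obj[OF f] by simp
  have "Zer C y z \<cdot> f = Add C (Zer C y z \<cdot> f) (Zer C y z \<cdot> f)"
    using comp_add_left[OF f zer_in[OF y z] zer_in[OF y z]] zer_add_zer[OF y z] by simp
  then show ?thesis using add_idem[OF comp_in_Hom[OF f zer_in[OF y z]]] by simp
qed

lemma comp_neg: assumes f: "f \<in> Hom C x y" and h: "h \<in> Hom C y z"
  shows "h \<cdot> Neg C f = Neg C (h \<cdot> f)"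
proof -
  have "Add C (h \<cdot> f) (h \<cdot> Neg C f) = Zer C x z"
    using comp_add_right[OF f neg_in[OF f] h] add_neg[OF f] comp_zer[OF h] Hom_obj[OF f] by simp
  from add_eq_zer[OF comp_in_Hom[OF f h] comp_in_Hom[OF neg_in[OF f] h] this]
  show ?thesis using neg_neg[OF comp_in_Hom[OF neg_in[OF f] h]] by simp
qed

lemma neg_comp: assumes f: "f \<in> Hom C x y" and h: "h \<in> Hom C y z"
  shows "Neg C h \<cdot> f = Neg C (h \<cdot> f)"
proof -
  have "Add C (h \<cdot> f) (Neg C h \<cdot> f) = Zer C x z"
    using comp_add_left[OF f h neg_in[OF h]] add_neg[OF h] zer_comp[OF f] Hom_obj[OF h] by simp
  from add_eq_zer[OF comp_in_Hom[OF f h] comp_in_Hom[OF f neg_in[OF h]] this]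
  show ?thesis using neg_neg[OF comp_in_Hom[OF f neg_in[OF h]]] by simp
qed

lemma neg_zer: "\<lbrakk>x \<in> Obj C; y \<in> Obj C\<rbrakk> \<Longrightarrow> Neg C (Zer C x y) = Zer C x y"
  using add_eq_zer[OF zer_in zer_in zer_add_zer, of x y] by metis

lemma diff_zer_imp_eq: "\<lbrakk>f \<in> Hom C x y; g \<in> Hom C x y; Add C f (Neg C g) = Zer C x y\<rbrakk> \<Longrightarrow> f = g"
  using add_eq_zer[of f x y "Neg C g"] neg_in neg_neg by metis

end

lemma isomorphicE:
  assumes "isomorphic C x y"
  obtains f g where "f \<in> Hom C x y" "g \<in> Hom C y x" "g \<cdot>\<^bsub>C\<^esub> f = Id C x" "f \<cdot>\<^bsub>C\<^esub> g = Id C y"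
  using assms unfolding isomorphic_def is_iso_def by (auto dest: HomD)

lemma isomorphicI:
  assumes "f \<in> Hom C x y" "g \<in> Hom C y x" "g \<cdot>\<^bsub>C\<^esub> f = Id C x" "f \<cdot>\<^bsub>C\<^esub> g = Id C y"
  shows "isomorphic C x y"
  using assms HomD[OF assms(1)] unfolding isomorphic_def is_iso_def by auto

context triangulated_category
begin

lemma susp_obj: "x \<in> Obj T \<Longrightarrow> SObj T x \<in> Obj T"
  and susp_id: "x \<in> Obj T \<Longrightarrow> SArr T (Id T x) = Id T (SObj T x)"
  and susp_in: "f \<in> Hom T x y \<Longrightarrow> SArr T f \<in> Hom T (SObj T x) (SObj T y)"
  and susp_comp: "\<lbrakk>f \<in> Hom T x y; g \<in> Hom T y z\<rbrakk> \<Longrightarrow> SArr T (g \<cdot> f) = SArr T g \<cdot> SArr T f"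
  using susp_functor unfolding is_functor_def by blast+

lemma susp_inj: "\<lbrakk>f \<in> Hom T x y; g \<in> Hom T x y; SArr T f = SArr T g\<rbrakk> \<Longrightarrow> f = g"
  using susp_fully_faithful[of x y] Hom_obj[of f x y] by (auto simp: bij_betw_def inj_on_def)

lemma susp_full: "\<lbrakk>x \<in> Obj T; y \<in> Obj T; g \<in> Hom T (SObj T x) (SObj T y)\<rbrakk>
    \<Longrightarrow> \<exists>f \<in> Hom T x y. SArr T f = g"
  using susp_fully_faithful[of x y] unfolding bij_betw_def by (metis imageE)

lemma susp_zer: assumes x: "x \<in> Obj T" and y: "y \<in> Obj T"
  shows "SArr T (Zer T x y) = Zer T (SObj T x) (SObj T y)"
  using add_idem[OF susp_in[OF zer_in[OF x y]]] susp_additive[OF zer_in[OF x y] zer_in[OF x y]]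
    zer_add_zer[OF x y] by simp

lemma isomorphic_trans: "\<lbrakk>isomorphic T x y; isomorphic T y z\<rbrakk> \<Longrightarrow> isomorphic T x z"
proof -
  assume "isomorphic T x y" "isomorphic T y z"
  then obtain f g h k where 1: "f \<in> Hom T x y" "g \<in> Hom T y x" "g \<cdot> f = Id T x" "f \<cdot> g = Id T y"
     and 2: "h \<in> Hom T y z" "k \<in> Hom T z y" "k \<cdot> h = Id T y" "h \<cdot> k = Id T z"
    by (metis isomorphicE)
  have hf: "h \<cdot> f \<in> Hom T x z" and gk: "g \<cdot> k \<in> Hom T z x" using 1 2 comp_in_Hom by blast+
  have a: "g \<cdot> k \<cdot> (h \<cdot> f) = Id T x"
    by (metis comp_assoc[OF hf 2(2) 1(2)] comp_assoc[OF 1(1) 2(1) 2(2)] comp_id_left[OF 1(1)] 2(3) 1(3))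
  have b: "h \<cdot> f \<cdot> (g \<cdot> k) = Id T z"
    by (metis comp_assoc[OF gk 1(1) 2(1)] comp_assoc[OF 2(2) 1(2) 1(1)] comp_id_left[OF 2(2)] 2(4) 1(4))
  from a b show ?thesis by (meson isomorphicI hf gk)
qed

lemma isomorphic_susp: assumes "isomorphic T x y" shows "isomorphic T (SObj T x) (SObj T y)"
proof -
  from assms obtain f g where 1: "f \<in> Hom T x y" "g \<in> Hom T y x" "g \<cdot> f = Id T x" "f \<cdot> g = Id T y"
    by (metis isomorphicE)
  have "SArr T g \<cdot> SArr T f = Id T (SObj T x)" "SArr T f \<cdot> SArr T g = Id T (SObj T y)"
    using 1 susp_comp susp_id Hom_obj by metis+
  then show ?thesis by (meson isomorphicI susp_in 1)
qed

lemma triangle_rotate: "triangle T x y z u v w \<Longrightarrow> triangle T y z (SObj T x) v w (Neg T (SArr T u))"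
  using TR2 unfolding triangle_def by blast

lemma triangle_exact:
  assumes tr: "triangle T x y z u v w" and g: "g \<in> Hom T t y" and vg: "v \<cdot> g = Zer T t z"
  shows "\<exists>h \<in> Hom T t x. u \<cdot> h = g"
proof -
  have u: "u \<in> Hom T x y" and v: "v \<in> Hom T y z" using tr by (auto simp: triangle_def)
  have ob: "t \<in> Obj T" "x \<in> Obj T" "y \<in> Obj T" "z \<in> Obj T" using Hom_obj g u v by blast+
  obtain n where n: "zero_object T n" using ex_zero_object by blast
  have nO: "n \<in> Obj T" using n by (simp add: zero_object_def)
  have 1: "triangle T t n (SObj T t) (Zer T t n) (Zer T n (SObj T t)) (Neg T (SArr T (Id T t)))"
    by (rule triangle_rotate[OF TR1_id[OF ob(1) n]])
  have "Zer T n z \<cdot> Zer T t n = v \<cdot> g"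
    using comp_zer[OF zer_in[OF nO ob(4)] ob(1)] vg by simp
  from TR3[OF 1 triangle_rotate[OF tr] g zer_in[OF nO ob(4)] this]
  obtain h' where h': "h' \<in> Hom T (SObj T t) (SObj T x)"
    and eq: "SArr T g \<cdot> Neg T (SArr T (Id T t)) = Neg T (SArr T u) \<cdot> h'" by blast
  obtain h where h: "h \<in> Hom T t x" "SArr T h = h'" using susp_full[OF ob(1,2) h'] by blast
  note Sg = susp_in[OF g] and Su = susp_in[OF u]
  have "SArr T g \<cdot> Neg T (SArr T (Id T t)) = Neg T (SArr T g)"
    using comp_neg[OF susp_in[OF id_in_Hom[OF ob(1)]] Sg] susp_id[OF ob(1)] comp_id_right[OF Sg] by simp
  moreover have "Neg T (SArr T u) \<cdot> h' = Neg T (SArr T u \<cdot> h')"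
    by (rule neg_comp[OF h' Su])
  ultimately have "Neg T (SArr T g) = Neg T (SArr T u \<cdot> h')" using eq by simp
  then have "SArr T g = SArr T u \<cdot> h'"
    using neg_neg[OF Sg] neg_neg[OF comp_in_Hom[OF h' Su]] by metis
  then have "SArr T g = SArr T (u \<cdot> h)" using susp_comp[OF h(1) u] h(2) by simp
  then have "g = u \<cdot> h" using susp_inj[OF g comp_in_Hom[OF h(1) u]] by simp
  then show ?thesis using h(1) by blast
qed

lemma triangle_mono:
  assumes tr: "triangle T x y z u v w" and d: "d \<in> Hom T t x" and ud: "u \<cdot> d = Zer T t y"
    and van: "Hom T (SObj T t) z = {Zer T (SObj T t) z}"
  shows "d = Zer T t x"
proof -
  have u: "u \<in> Hom T x y" and w: "w \<in> Hom T z (SObj T x)" using tr by (auto simp: triangle_def)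
  have ob: "t \<in> Obj T" "x \<in> Obj T" "y \<in> Obj T" using Hom_obj d u by blast+
  have "Neg T (SArr T u) \<cdot> SArr T d = Zer T (SObj T t) (SObj T y)"
    using neg_comp[OF susp_in[OF d] susp_in[OF u]] susp_comp[OF d u] ud susp_zer[OF ob(1,3)]
      neg_zer[OF susp_obj[OF ob(1)] susp_obj[OF ob(3)]] by simp
  from triangle_exact[OF triangle_rotate[OF triangle_rotate[OF tr]] susp_in[OF d] this]
  obtain k where "k \<in> Hom T (SObj T t) z" "w \<cdot> k = SArr T d" by blast
  then have "SArr T d = w \<cdot> Zer T (SObj T t) z" using van by auto
  also have "\<dots> = SArr T (Zer T t x)"
    using comp_zer[OF w susp_obj[OF ob(1)]] susp_zer[OF ob(1,2)] by simp
  finally show ?thesis using susp_inj[OF d zer_in[OF ob(1,2)]] by simp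
qed

lemma Hom_zero_iso:
  assumes H: "Hom T x y = {Zer T x y}" and ix: "isomorphic T x' x" and iy: "isomorphic T y' y"
  shows "Hom T x' y' = {Zer T x' y'}"
proof -
  from ix obtain f g where 1: "f \<in> Hom T x' x" "g \<in> Hom T x x'" "g \<cdot> f = Id T x'" by (metis isomorphicE)
  from iy obtain h k where 2: "h \<in> Hom T y' y" "k \<in> Hom T y y'" "k \<cdot> h = Id T y'" by (metis isomorphicE)
  have ob: "x' \<in> Obj T" "y' \<in> Obj T" "x \<in> Obj T" "y \<in> Obj T" using 1 2 Hom_obj by blast+
  have "a = Zer T x' y'" if a: "a \<in> Hom T x' y'" for a
  proof -
    have ag: "a \<cdot> g \<in> Hom T x y'" using comp_in_Hom[OF 1(2) a] .
    have "h \<cdot> (a \<cdot> g) = Zer T x y" using comp_in_Hom[OF ag 2(1)] H by blast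
    then have "k \<cdot> (h \<cdot> (a \<cdot> g)) = Zer T x y'" using comp_zer[OF 2(2) ob(3)] by simp
    then have "a \<cdot> g = Zer T x y'" using comp_assoc[OF ag 2(1,2)] 2(3) comp_id_left[OF ag] by simp
    then have "(a \<cdot> g) \<cdot> f = Zer T x' y'" using zer_comp[OF 1(1) ob(2)] by simp
    then show ?thesis using comp_assoc[OF 1(1,2) a] 1(3) comp_id_right[OF a] by simp
  qed
  then show ?thesis using zer_in[OF ob(1,2)] by blast
qed

lemma Hom_zero_susp:
  assumes "Hom T x y = {Zer T x y}" "x \<in> Obj T" "y \<in> Obj T"
  shows "Hom T (SObj T x) (SObj T y) = {Zer T (SObj T x) (SObj T y)}"
  using bij_betw_imp_surj_on[OF susp_fully_faithful[OF assms(2,3)]] susp_zer[OF assms(2,3)]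
  by (metis assms(1) image_empty image_insert)

lemma Hom_susp_vanish:
  assumes AO: "\<A> \<subseteq> Obj T" and van: "\<And>i. i \<in> {1, 2} \<Longrightarrow> Hom_vanishes T \<A> (desusp T i \<A>)"
    and t: "t \<in> susp T \<A>" and a: "a \<in> \<A>"
  shows "Hom T t a = {Zer T t a}" "Hom T (SObj T t) a = {Zer T (SObj T t) a}"
proof -
  obtain b where b: "b \<in> \<A>" "isomorphic T t (SObj T b)" using t by (auto simp: susp_def)
  have ob: "b \<in> Obj T" "a \<in> Obj T" using AO a b by auto
  obtain y where y: "y \<in> Obj T" "isomorphic T (SObj T y) a" using susp_ess_surj[OF ob(2)] by blast
  obtain z where z: "z \<in> Obj T" "isomorphic T (SObj T z) y" using susp_ess_surj[OF y(1)] by blast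
  have sym: "isomorphic T p q" if "isomorphic T q p" for p q
    using that isomorphicE isomorphicI by metis
  have z2: "isomorphic T (SObj T (SObj T z)) a" using isomorphic_trans[OF isomorphic_susp[OF z(2)] y(2)] .
  have "y \<in> desusp T 1 \<A>" using y a by (auto simp: desusp_def)
  then have "Hom T b y = {Zer T b y}" using van[of 1] b(1) by (auto simp: Hom_vanishes_def)
  from Hom_zero_iso[OF Hom_zero_susp[OF this ob(1) y(1)] b(2) sym[OF y(2)]]
  show "Hom T t a = {Zer T t a}" .
  have "z \<in> desusp T 2 \<A>" using z z2 a by (auto simp: desusp_def numeral_2_eq_2)
  then have "Hom T b z = {Zer T b z}" using van[of 2] b(1) by (auto simp: Hom_vanishes_def)
  from Hom_zero_susp[OF Hom_zero_susp[OF this ob(1) z(1)] susp_obj[OF ob(1)] susp_obj[OF z(1)]]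
  show "Hom T (SObj T t) a = {Zer T (SObj T t) a}"
    by (rule Hom_zero_iso[OF _ isomorphic_susp[OF b(2)] sym[OF z2]])
qed

lemma ex_unique_lift:
  assumes AO: "\<A> \<subseteq> Obj T" and van: "\<And>i. i \<in> {1, 2} \<Longrightarrow> Hom_vanishes T \<A> (desusp T i \<A>)"
    and c: "c \<in> star T (susp T \<A>) \<A>"
  shows "\<exists>a \<in> \<A>. \<exists>\<phi> \<in> Hom T (SObj T a) c. \<forall>t \<in> susp T \<A>. \<forall>f \<in> Hom T t c.
           \<exists>!g. g \<in> Hom T t (SObj T a) \<and> \<phi> \<cdot> g = f"
proof -
  obtain x y u v w where xy: "x \<in> susp T \<A>" "y \<in> \<A>" and tr: "triangle T x c y u v w"
    using c by (auto simp: star_def)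
  obtain a where a: "a \<in> \<A>" "isomorphic T x (SObj T a)" using xy(1) by (auto simp: susp_def)
  obtain k e where ke: "k \<in> Hom T x (SObj T a)" "e \<in> Hom T (SObj T a) x"
      "e \<cdot> k = Id T x" "k \<cdot> e = Id T (SObj T a)" using isomorphicE[OF a(2)] by metis
  have u: "u \<in> Hom T x c" and v: "v \<in> Hom T c y" using tr by (auto simp: triangle_def)
  have "\<exists>!g. g \<in> Hom T t (SObj T a) \<and> (u \<cdot> e) \<cdot> g = f" if t: "t \<in> susp T \<A>" and f: "f \<in> Hom T t c" for t f
  proof -
    note V = Hom_susp_vanish[OF AO van t xy(2)]
    have "v \<cdot> f = Zer T t y" using comp_in_Hom[OF f v] V(1) by blast
    from triangle_exact[OF tr f this] obtain h where h: "h \<in> Hom T t x" "u \<cdot> h = f" by blast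
    show ?thesis
    proof (rule ex1I[of _ "k \<cdot> h"])
      have "e \<cdot> (k \<cdot> h) = h" using comp_assoc[OF h(1) ke(1,2)] ke(3) comp_id_left[OF h(1)] by simp
      then show "k \<cdot> h \<in> Hom T t (SObj T a) \<and> u \<cdot> e \<cdot> (k \<cdot> h) = f"
        using comp_in_Hom[OF h(1) ke(1)] comp_assoc[OF comp_in_Hom[OF h(1) ke(1)] ke(2) u] h(2) by simp
    next
      fix g assume g: "g \<in> Hom T t (SObj T a) \<and> u \<cdot> e \<cdot> g = f"
      have eg: "e \<cdot> g \<in> Hom T t x" using comp_in_Hom[of g t _ e x] g ke(2) by blast
      have ueg: "u \<cdot> (e \<cdot> g) = f" using comp_assoc[of g t _ e x u c] g ke(2) u by auto
      let ?d = "Add T (e \<cdot> g) (Neg T h)"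
      have d: "?d \<in> Hom T t x" using add_in[OF eg neg_in[OF h(1)]] .
      have "u \<cdot> ?d = Zer T t c"
        using comp_add_right[OF eg neg_in[OF h(1)] u] comp_neg[OF h(1) u] h(2) ueg add_neg[OF f] by simp
      from triangle_mono[OF tr d this V(2)] have "e \<cdot> g = h" using diff_zer_imp_eq[OF eg h(1)] by simp
      then have "k \<cdot> (e \<cdot> g) = k \<cdot> h" by simp
      then show "g = k \<cdot> h"
        using comp_assoc[of g t _ e x k "SObj T a"] g ke comp_id_left[of g t "SObj T a"] by auto
    qed
  qed
  then show ?thesis using a(1) comp_in_Hom[OF ke(2) u] by blast
qed

theorem ex_approximation_functor:
  assumes AO: "\<A> \<subseteq> Obj T" and van: "\<And>i. i \<in> {1, 2} \<Longrightarrow> Hom_vanishes T \<A> (desusp T i \<A>)"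
  shows "\<exists>Fo Fm \<phi>. approximation_functor T \<A> Fo Fm \<phi>"
proof -
  let ?S = "star T (susp T \<A>) \<A>"
  have "\<forall>c \<in> ?S. \<exists>a\<phi>. fst a\<phi> \<in> \<A> \<and> snd a\<phi> \<in> Hom T (SObj T (fst a\<phi>)) c \<and>
     (\<forall>t \<in> susp T \<A>. \<forall>f \<in> Hom T t c. \<exists>!g. g \<in> Hom T t (SObj T (fst a\<phi>)) \<and> snd a\<phi> \<cdot> g = f)"
  proof
    fix c assume "c \<in> ?S"
    from ex_unique_lift[OF AO van this] obtain a \<phi> where "a \<in> \<A>" "\<phi> \<in> Hom T (SObj T a) c"
      "\<forall>t \<in> susp T \<A>. \<forall>f \<in> Hom T t c. \<exists>!g. g \<in> Hom T t (SObj T a) \<and> \<phi> \<cdot> g = f" by blast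
    then show "\<exists>a\<phi>. fst a\<phi> \<in> \<A> \<and> snd a\<phi> \<in> Hom T (SObj T (fst a\<phi>)) c \<and>
      (\<forall>t \<in> susp T \<A>. \<forall>f \<in> Hom T t c. \<exists>!g. g \<in> Hom T t (SObj T (fst a\<phi>)) \<and> snd a\<phi> \<cdot> g = f)"
      by (intro exI[of _ "(a, \<phi>)"]) simp
  qed
  from bchoice[OF this] obtain F where F: "\<And>c. c \<in> ?S \<Longrightarrow> fst (F c) \<in> \<A>"
    "\<And>c. c \<in> ?S \<Longrightarrow> snd (F c) \<in> Hom T (SObj T (fst (F c))) c"
    "\<And>c t f. \<lbrakk>c \<in> ?S; t \<in> susp T \<A>; f \<in> Hom T t c\<rbrakk>
        \<Longrightarrow> \<exists>!g. g \<in> Hom T t (SObj T (fst (F c))) \<and> snd (F c) \<cdot> g = f" by blast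
  define Fo where "Fo = (\<lambda>c. fst (F c))"
  define \<phi> where "\<phi> = (\<lambda>c. snd (F c))"
  define P where "P = (\<lambda>f m. m \<in> Hom T (Fo (Dom T f)) (Fo (Cod T f)) \<and>
       \<phi> (Cod T f) \<cdot> SArr T m = f \<cdot> \<phi> (Dom T f))"
  define Fm where "Fm = (\<lambda>f. THE m. P f m)"
  have FA: "Fo c \<in> \<A>" and FO: "Fo c \<in> Obj T" and \<phi>: "\<phi> c \<in> Hom T (SObj T (Fo c)) c" if "c \<in> ?S" for c
    using F(1,2) that AO by (auto simp: Fo_def \<phi>_def)
  have sus: "SObj T a \<in> susp T \<A>" if "a \<in> \<A>" for a
  proof -
    have "SObj T a \<in> Obj T" using that AO susp_obj by blast
    then have "isomorphic T (SObj T a) (SObj T a)"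
      using isomorphicI[of "Id T (SObj T a)"] id_in_Hom comp_id_left by metis
    then show ?thesis using that \<open>SObj T a \<in> Obj T\<close> by (auto simp: susp_def)
  qed
  have lift: "\<exists>!g. g \<in> Hom T t (SObj T (Fo c)) \<and> \<phi> c \<cdot> g = f"
    if "c \<in> ?S" "t \<in> susp T \<A>" "f \<in> Hom T t c" for c t f
    using F(3)[OF that] by (simp add: Fo_def \<phi>_def)
  have uniq: "\<exists>!m. P f m" if cS: "c \<in> ?S" "c' \<in> ?S" and f: "f \<in> Hom T c c'" for c c' f
  proof -
    have dc: "Dom T f = c" "Cod T f = c'" using HomD[OF f] by auto
    from lift[OF cS(2) sus[OF FA[OF cS(1)]] comp_in_Hom[OF \<phi>[OF cS(1)] f]]
    obtain g where g: "g \<in> Hom T (SObj T (Fo c)) (SObj T (Fo c'))" "\<phi> c' \<cdot> g = f \<cdot> \<phi> c"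
      and gu: "\<And>h. h \<in> Hom T (SObj T (Fo c)) (SObj T (Fo c')) \<Longrightarrow> \<phi> c' \<cdot> h = f \<cdot> \<phi> c \<Longrightarrow> h = g" by blast
    obtain m where m: "m \<in> Hom T (Fo c) (Fo c')" "SArr T m = g"
      using susp_full[OF FO[OF cS(1)] FO[OF cS(2)] g(1)] by blast
    show ?thesis
    proof (rule ex1I[of _ m])
      show "P f m" using m g by (simp add: P_def dc)
    next
      fix m' assume "P f m'"
      then have m': "m' \<in> Hom T (Fo c) (Fo c')" "\<phi> c' \<cdot> SArr T m' = f \<cdot> \<phi> c" by (auto simp: P_def dc)
      then show "m' = m" using gu[OF susp_in[OF m'(1)]] susp_inj[OF m'(1) m(1)] m(2) by simp
    qed
  qed
  have PFm: "P f (Fm f)" if "c \<in> ?S" "c' \<in> ?S" "f \<in> Hom T c c'" for c c' f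
    unfolding Fm_def by (rule theI'[OF uniq[OF that]])
  have FmI: "Fm f = m" if "c \<in> ?S" "c' \<in> ?S" "f \<in> Hom T c c'" "P f m" for c c' f m
    using uniq[OF that(1-3)] PFm[OF that(1-3)] that(4) by blast
  have Fmin: "Fm f \<in> Hom T (Fo c) (Fo c')" and Fmeq: "\<phi> c' \<cdot> SArr T (Fm f) = f \<cdot> \<phi> c"
    if "c \<in> ?S" "c' \<in> ?S" "f \<in> Hom T c c'" for c c' f
    using PFm[OF that] HomD[OF that(3)] by (auto simp: P_def)
  have Hsub: "f \<in> Hom (full_subcat T X) x y \<longleftrightarrow> f \<in> Hom T x y \<and> x \<in> X \<and> y \<in> X" for X f x y
    by (auto simp: Hom_def full_subcat_def)
  have sub: "Id (full_subcat T X) = Id T" "Obj (full_subcat T X) = X"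
     "Comp (full_subcat T X) = Comp T" for X
    by (simp_all add: full_subcat_def)
  have "is_functor (full_subcat T ?S) (full_subcat T \<A>) Fo Fm"
    unfolding is_functor_def Hsub sub
  proof (intro conjI ballI allI impI)
    fix c assume c: "c \<in> ?S"
    then have cO: "c \<in> Obj T" by (auto simp: star_def)
    show "Fo c \<in> \<A>" by (rule FA[OF c])
    have "P (Id T c) (Id T (Fo c))"
      using HomD[OF id_in_Hom[OF cO]] id_in_Hom[OF FO[OF c]] susp_id[OF FO[OF c]]
        comp_id_left[OF \<phi>[OF c]] comp_id_right[OF \<phi>[OF c]] by (simp add: P_def)
    then show "Fm (Id T c) = Id T (Fo c)" by (rule FmI[OF c c id_in_Hom[OF cO]])
  next
    fix x y f assume "f \<in> Hom (full_subcat T ?S) x y"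
    then have f: "x \<in> ?S" "y \<in> ?S" "f \<in> Hom T x y" by (auto simp: Hsub)
    show "Fm f \<in> Hom T (Fo x) (Fo y)" "Fo x \<in> \<A>" "Fo y \<in> \<A>" using Fmin[OF f] FA f by auto
  next
    fix x y z f g assume "f \<in> Hom (full_subcat T ?S) x y" "g \<in> Hom (full_subcat T ?S) y z"
    then have f: "x \<in> ?S" "y \<in> ?S" "f \<in> Hom T x y" and g: "y \<in> ?S" "z \<in> ?S" "g \<in> Hom T y z"
      by (auto simp: Hsub)
    have gf: "g \<cdot> f \<in> Hom T x z" using comp_in_Hom[OF f(3) g(3)] .
    note Ff = Fmin[OF f] and Fg = Fmin[OF g]
    have "\<phi> z \<cdot> (SArr T (Fm g) \<cdot> SArr T (Fm f)) = g \<cdot> (\<phi> y \<cdot> SArr T (Fm f))"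
      using comp_assoc[OF susp_in[OF Ff] susp_in[OF Fg] \<phi>[OF g(2)]] Fmeq[OF g]
        comp_assoc[OF susp_in[OF Ff] \<phi>[OF f(2)] g(3)] by simp
    also have "\<dots> = (g \<cdot> f) \<cdot> \<phi> x"
      using Fmeq[OF f] comp_assoc[OF \<phi>[OF f(1)] f(3) g(3)] by simp
    finally have "P (g \<cdot> f) (Fm g \<cdot> Fm f)"
      using HomD[OF gf] comp_in_Hom[OF Ff Fg] susp_comp[OF Ff Fg] by (simp add: P_def)
    then show "Fm (g \<cdot> f) = Fm g \<cdot> Fm f" by (rule FmI[OF f(1) g(2) gf])
  qed
  moreover have "minimal_right_approximation T (susp T \<A>) c (SObj T (Fo c)) (\<phi> c)" if c: "c \<in> ?S" for c
    unfolding minimal_right_approximation_def right_approximation_def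
  proof (intro conjI ballI impI)
    show "SObj T (Fo c) \<in> susp T \<A>" "\<phi> c \<in> Hom T (SObj T (Fo c)) c" using sus FA \<phi> c by auto
    fix x' f assume "x' \<in> susp T \<A>" "f \<in> Hom T x' c"
    from lift[OF c this] show "\<exists>g \<in> Hom T x' (SObj T (Fo c)). \<phi> c \<cdot> g = f" by blast
  next
    fix e assume e: "e \<in> Hom T (SObj T (Fo c)) (SObj T (Fo c))" "\<phi> c \<cdot> e = \<phi> c"
    let ?i = "Id T (SObj T (Fo c))"
    have i: "?i \<in> Hom T (SObj T (Fo c)) (SObj T (Fo c))" using id_in_Hom susp_obj FO[OF c] by blast
    have ei: "e = ?i" using lift[OF c sus[OF FA[OF c]] \<phi>[OF c]] e i comp_id_right[OF \<phi>[OF c]] by blast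
    have "Dom T ?i = SObj T (Fo c)" "Cod T ?i = SObj T (Fo c)" "?i \<in> Arr T" using HomD[OF i] by auto
    then show "is_iso T e" using i comp_id_right[OF i] unfolding is_iso_def ei by auto
  qed
  ultimately have "approximation_functor T \<A> Fo Fm \<phi>"
    using Fmeq unfolding approximation_functor_def by blast
  then show ?thesis by blast
qed

end

end

theory Submission
  imports Defs
begin

text \<open>
  Since there are no nonzero maps from \<open>\<Sigma>\<A>\<close> and \<open>\<Sigma>\<^sup>2\<A>\<close> to \<open>\<A>\<close>, every map from an object of \<open>\<Sigma>\<A>\<close>
  to \<open>c\<close> lifts uniquely along the first map of a triangle \<open>\<Sigma>f \<rightarrow> c \<rightarrow> a \<rightarrow> \<Sigma>\<^sup>2f\<close>; hence \<open>F c \<cong> f\<close>.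

  For a torsion-free class \<open>\<F>\<close>, the cone of a map \<open>f \<rightarrow> a\<close> in \<open>\<A>\<close> is an extension of its cokernel by the
  suspension of its kernel, so \<open>\<A> * \<Sigma>\<F> \<subseteq> \<Sigma>\<F> * \<A>\<close>, and associativity of \<open>*\<close> makes \<open>\<Sigma>\<F> * \<A>\<close> extension
  closed. An idempotent on \<open>c \<in> \<Sigma>\<F> * \<A>\<close> lifts to one on \<open>f\<close>, which splits in \<open>\<A>\<close>; thus summands
  of \<open>c\<close> stay in \<open>\<Sigma>\<F> * \<A>\<close>.

  For \<open>\<C>\<close> as in part (2) the point is that \<open>\<Sigma>f \<in> \<C>\<close> whenever \<open>\<Sigma>f \<rightarrow> c \<rightarrow> a\<close> is a triangle with \<open>c \<in> \<C>\<close>.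
  Take \<open>a' \<rightarrow> c \<rightarrow> \<Sigma>b\<close> from \<open>c \<in> \<A> * \<Sigma>\<A>\<close>. The composite \<open>g: a' \<rightarrow> c \<rightarrow> a\<close> is epic in \<open>\<A>\<close>; let \<open>x\<close> be its
  kernel. The fibre \<open>y\<close> of \<open>c \<rightarrow> a \<rightarrow> \<Sigma>x\<close> lies in \<open>\<A> * \<C> \<subseteq> \<C>\<close>, and by the octahedral axiom it is an
  extension of \<open>a'\<close> by \<open>\<Sigma>f\<close>. This extension splits because \<open>g\<close> factors through \<open>c\<close>, so \<open>\<Sigma>f\<close> is a
  summand of \<open>y\<close>. Therefore \<open>F(\<C>) = {f \<in> \<A>. \<Sigma>f \<in> \<C>}\<close>.
\<close>

section \<open>Preadditive and abelian categories\<close>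

text \<open>No complement is asked for, which makes the notion easy to move along functors and
  triangles. \<open>retract_direct_sum\<close> supplies the complement in \<open>T\<close>, so
  closure under summands can be tested on retracts.\<close>

definition retract :: "('o, 'm, 'z) cat_data_scheme \<Rightarrow> 'o \<Rightarrow> 'o \<Rightarrow> bool" where
  "retract C x y \<longleftrightarrow> (\<exists>i \<in> Hom C x y. \<exists>p \<in> Hom C y x. p \<cdot>\<^bsub>C\<^esub> i = Id C x)"

lemma direct_sum_retract: "direct_sum C z x y \<Longrightarrow> retract C x z \<and> retract C y z"
  unfolding direct_sum_def retract_def by blast

lemma isomorphic_retract: "isomorphic C x y \<Longrightarrow> retract C x y"
  unfolding retract_def by (metis isomorphicE)

lemma isomorphic_sym: "isomorphic C x y \<Longrightarrow> isomorphic C y x"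
  by (metis isomorphicE isomorphicI)

lemma (in category) isomorphic_refl: "x \<in> Obj C \<Longrightarrow> isomorphic C x x"
  using isomorphicI id_in_Hom comp_id_left by metis

lemma (in category) isomorphic_obj: "isomorphic C x y \<Longrightarrow> x \<in> Obj C \<and> y \<in> Obj C"
  by (metis isomorphicE Hom_obj)

lemma is_isoI:
  assumes "f \<in> Hom C x y" "g \<in> Hom C y x" "g \<cdot>\<^bsub>C\<^esub> f = Id C x" "f \<cdot>\<^bsub>C\<^esub> g = Id C y"
  shows "is_iso C f"
  using assms HomD[OF assms(1)] unfolding is_iso_def by auto

lemma (in category) is_iso_id: "x \<in> Obj C \<Longrightarrow> is_iso C (Id C x)"
  using is_isoI[OF id_in_Hom id_in_Hom] comp_id_left[OF id_in_Hom] by metis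

lemma (in category) epic_comp:
  assumes "epic C f" "epic C g" "f \<in> Hom C x y" "g \<in> Hom C y z"
  shows "epic C (g \<cdot> f)"
  unfolding epic_def
proof (intro conjI allI ballI impI)
  show "g \<cdot> f \<in> Arr C" using HomD[OF comp_in_Hom[OF assms(3,4)]] by simp
  fix w s t assume s: "s \<in> Hom C (Cod C (g \<cdot> f)) w" and t: "t \<in> Hom C (Cod C (g \<cdot> f)) w"
    and e: "s \<cdot> (g \<cdot> f) = t \<cdot> (g \<cdot> f)"
  have s: "s \<in> Hom C z w" and t: "t \<in> Hom C z w" using s t HomD[OF comp_in_Hom[OF assms(3,4)]] by auto
  have "(s \<cdot> g) \<cdot> f = (t \<cdot> g) \<cdot> f" using comp_assoc[OF assms(3,4) s] comp_assoc[OF assms(3,4) t] e by simp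
  then have "s \<cdot> g = t \<cdot> g"
    using assms(1) comp_in_Hom[OF assms(4) s] comp_in_Hom[OF assms(4) t] HomD[OF assms(3)]
    unfolding epic_def by blast
  then show "s = t" using assms(2) s t HomD[OF assms(4)] unfolding epic_def by blast
qed

lemma full_subcat_simps [simp]:
  "Obj (full_subcat C X) = X" "Dom (full_subcat C X) = Dom C" "Cod (full_subcat C X) = Cod C"
  "Id (full_subcat C X) = Id C" "Comp (full_subcat C X) = Comp C" "Add (full_subcat C X) = Add C"
  "Zer (full_subcat C X) = Zer C"
  by (simp_all add: full_subcat_def)

lemma Hom_full_subcat: "f \<in> Hom (full_subcat C X) x y \<longleftrightarrow> f \<in> Hom C x y \<and> x \<in> X \<and> y \<in> X"
  by (auto simp: Hom_def full_subcat_def)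

lemma isomorphic_full_subcat:
  "isomorphic (full_subcat C X) x y \<longleftrightarrow> isomorphic C x y \<and> x \<in> X \<and> y \<in> X"
proof
  assume "isomorphic (full_subcat C X) x y"
  then show "isomorphic C x y \<and> x \<in> X \<and> y \<in> X"
    by (rule isomorphicE) (auto simp: Hom_full_subcat intro: isomorphicI)
next
  assume "isomorphic C x y \<and> x \<in> X \<and> y \<in> X"
  then show "isomorphic (full_subcat C X) x y"
    by (metis isomorphicE isomorphicI Hom_full_subcat full_subcat_simps(4,5))
qed

lemma direct_sum_full_subcat:
  "X \<subseteq> Obj C \<Longrightarrow> direct_sum (full_subcat C X) z x y \<longleftrightarrow> direct_sum C z x y \<and> x \<in> X \<and> y \<in> X \<and> z \<in> X"
  unfolding direct_sum_def Bex_def Hom_full_subcat full_subcat_simps by blast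

section \<open>Subtraction, zero objects, kernels and cokernels\<close>

context preadditive_category
begin

lemma hom_add_assoc:
  assumes "f \<in> Hom C x y" "g \<in> Hom C x y" "h \<in> Hom C x y"
  shows "Add C (Add C f g) h = Add C f (Add C g h)"
  using monoid.m_assoc[OF group.is_monoid[OF Hom_grp], of x y f g h] assms Hom_obj[OF assms(1)] by simp

lemma hom_add_commute:
  assumes "f \<in> Hom C x y" "g \<in> Hom C x y"
  shows "Add C f g = Add C g f"
  using comm_monoid.m_comm[of "Hom_group C x y" f g] Hom_comm_group[of x y] assms Hom_obj[OF assms(1)]
  by (simp add: comm_group_def)

lemma add_zer: assumes "f \<in> Hom C x y" shows "Add C f (Zer C x y) = f" "Add C (Zer C x y) f = f"
  using monoid.r_one[OF group.is_monoid[OF Hom_grp], of x y f]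
    monoid.l_one[OF group.is_monoid[OF Hom_grp], of x y f] assms Hom_obj[OF assms] by simp_all

definition Sub :: "'b \<Rightarrow> 'b \<Rightarrow> 'b" where "Sub f g = Add C f (Neg C g)"

lemma sub_in: "\<lbrakk>f \<in> Hom C x y; g \<in> Hom C x y\<rbrakk> \<Longrightarrow> Sub f g \<in> Hom C x y"
  unfolding Sub_def by (intro add_in neg_in)

lemma sub_self: "f \<in> Hom C x y \<Longrightarrow> Sub f f = Zer C x y"
  unfolding Sub_def by (rule add_neg)

lemma sub_zer: "f \<in> Hom C x y \<Longrightarrow> Sub f (Zer C x y) = f"
  unfolding Sub_def using neg_zer[of x y] add_zer(1)[of f x y] Hom_obj by simp

lemma sub_eq_zer: "\<lbrakk>f \<in> Hom C x y; g \<in> Hom C x y; Sub f g = Zer C x y\<rbrakk> \<Longrightarrow> f = g"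
  unfolding Sub_def by (rule diff_zer_imp_eq)

lemma comp_sub:
  assumes "f \<in> Hom C x y" "g \<in> Hom C x y" "h \<in> Hom C y z"
  shows "h \<cdot> Sub f g = Sub (h \<cdot> f) (h \<cdot> g)"
  unfolding Sub_def using comp_add_right[OF assms(1) neg_in[OF assms(2)] assms(3)] comp_neg[OF assms(2,3)] by simp

lemma sub_comp:
  assumes "f \<in> Hom C x y" "g \<in> Hom C y z" "h \<in> Hom C y z"
  shows "Sub g h \<cdot> f = Sub (g \<cdot> f) (h \<cdot> f)"
  unfolding Sub_def using comp_add_left[OF assms(1,2) neg_in[OF assms(3)]] neg_comp[OF assms(1,3)] by simp

lemma add_sub:
  assumes f: "f \<in> Hom C x y" and g: "g \<in> Hom C x y"
  shows "Add C g (Sub f g) = f"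
  unfolding Sub_def
  using hom_add_assoc[OF f neg_in[OF g] g] hom_add_commute[OF g add_in[OF f neg_in[OF g]]]
    hom_add_commute[OF g neg_in[OF g]] add_neg[OF g] add_zer[OF f] by simp

lemma sub_sub:
  assumes f: "f \<in> Hom C x y" and g: "g \<in> Hom C x y"
  shows "Sub f (Sub f g) = g"
proof -
  have s: "Sub f g \<in> Hom C x y" using sub_in[OF f g] .
  have "Sub f (Sub f g) = Add C (Add C g (Sub f g)) (Neg C (Sub f g))"
    unfolding add_sub[OF f g] by (simp add: Sub_def)
  also have "\<dots> = g" using hom_add_assoc[OF g s neg_in[OF s]] add_neg[OF s] add_zer[OF g] by simp
  finally show ?thesis .
qed

lemma neg_neg_comp:
  assumes "f \<in> Hom C x y" "g \<in> Hom C y z"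
  shows "Neg C g \<cdot> Neg C f = g \<cdot> f"
  using neg_comp[OF neg_in[OF assms(1)] assms(2)] comp_neg[OF assms] neg_neg[OF comp_in_Hom[OF assms]] by simp

lemma neg_inj: "\<lbrakk>f \<in> Hom C x y; g \<in> Hom C x y; Neg C f = Neg C g\<rbrakk> \<Longrightarrow> f = g"
  by (metis neg_neg)

text \<open>A full subcategory shares \<open>Id\<close> and \<open>Zer\<close> with its ambient
  category, so this criterion moves zero objects between \<open>\<A>c\<close> and
  \<open>T\<close>.\<close>

lemma zero_object_iff: "zero_object C x \<longleftrightarrow> x \<in> Obj C \<and> Id C x = Zer C x x"
proof
  assume z: "zero_object C x"
  then have x: "x \<in> Obj C" by (simp add: zero_object_def)
  then show "x \<in> Obj C \<and> Id C x = Zer C x x"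
    using z id_in_Hom[OF x] zer_in[OF x x] unfolding zero_object_def by blast
next
  assume x: "x \<in> Obj C \<and> Id C x = Zer C x x"
  then have xo: "x \<in> Obj C" by simp
  have "f = Zer C x y" if f: "f \<in> Hom C x y" for y f
    using comp_id_right[OF f] comp_zer[OF f xo] x by simp
  moreover have "f = Zer C y x" if f: "f \<in> Hom C y x" for y f
    using comp_id_left[OF f] zer_comp[OF f xo] x by simp
  ultimately show "zero_object C x"
    unfolding zero_object_def using xo zer_in by metis
qed

text \<open>Makes closure under direct sums a special case of closure under extensions.\<close>

lemma direct_sum_short_exact:
  assumes "direct_sum C z x y"
  obtains i q where "i \<in> Hom C x z" "q \<in> Hom C z y" "short_exact C i q"
proof -
  obtain i j p q where h: "i \<in> Hom C x z" "j \<in> Hom C y z" "p \<in> Hom C z x" "q \<in> Hom C z y"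
    "p \<cdot> i = Id C x" "q \<cdot> j = Id C y" "p \<cdot> j = Zer C y x" "q \<cdot> i = Zer C x y"
    "Add C (i \<cdot> p) (j \<cdot> q) = Id C z"
    and o: "x \<in> Obj C" "y \<in> Obj C" "z \<in> Obj C"
    using assms unfolding direct_sum_def by metis
  note ip = comp_in_Hom[OF h(3) h(1)] and jq = comp_in_Hom[OF h(4) h(2)]
  have "is_kernel C i q"
    unfolding is_kernel_def
  proof (intro conjI allI ballI impI)
    fix w t assume t: "t \<in> Hom C w (Dom C q)" and qt: "q \<cdot> t = Zer C w (Cod C q)"
    have t: "t \<in> Hom C w z" and qt: "q \<cdot> t = Zer C w y" using t qt HomD[OF h(4)] by auto
    have w: "w \<in> Obj C" using Hom_obj[OF t] by simp
    have "Add C (i \<cdot> p \<cdot> t) (j \<cdot> q \<cdot> t) = t"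
      using comp_add_left[OF t ip jq] h(9) comp_id_left[OF t] by simp
    moreover have "j \<cdot> q \<cdot> t = Zer C w z" using comp_assoc[OF t h(4,2)] qt comp_zer[OF h(2) w] by simp
    ultimately have e: "i \<cdot> (p \<cdot> t) = t"
      using comp_assoc[OF t h(3,1)] add_zer(1)[OF comp_in_Hom[OF comp_in_Hom[OF t h(3)] h(1)]] by simp
    have u: "s = p \<cdot> t" if s: "s \<in> Hom C w x" "i \<cdot> s = t" for s
      using comp_assoc[OF s(1) h(1,3)] h(5) comp_id_left[OF s(1)] s(2) by simp
    have "Dom C i = x" using HomD[OF h(1)] by simp
    then show "\<exists>!s. s \<in> Hom C w (Dom C i) \<and> i \<cdot> s = t"
      using e comp_in_Hom[OF t h(3)] u by metis
  qed (use HomD[OF h(1)] HomD[OF h(4)] h(8) in auto)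
  moreover have "is_cokernel C q i"
    unfolding is_cokernel_def
  proof (intro conjI allI ballI impI)
    fix w t assume t: "t \<in> Hom C (Cod C i) w" and ti: "t \<cdot> i = Zer C (Dom C i) w"
    have t: "t \<in> Hom C z w" and ti: "t \<cdot> i = Zer C x w" using t ti HomD[OF h(1)] by auto
    have w: "w \<in> Obj C" using Hom_obj[OF t] by simp
    have "Add C (t \<cdot> (i \<cdot> p)) (t \<cdot> (j \<cdot> q)) = t"
      using comp_add_right[OF ip jq t] h(9) comp_id_right[OF t] by simp
    moreover have "t \<cdot> (i \<cdot> p) = Zer C z w" using comp_assoc[OF h(3,1) t] ti zer_comp[OF h(3) w] by simp
    ultimately have e: "(t \<cdot> j) \<cdot> q = t"
      using comp_assoc[OF h(4,2) t] add_zer(2)[OF comp_in_Hom[OF h(4) comp_in_Hom[OF h(2) t]]] by simp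
    have u: "s = t \<cdot> j" if s: "s \<in> Hom C y w" "s \<cdot> q = t" for s
      using comp_assoc[OF h(2,4) s(1)] h(6) comp_id_right[OF s(1)] s(2) by simp
    have "Cod C q = y" using HomD[OF h(4)] by simp
    then show "\<exists>!s. s \<in> Hom C (Cod C q) w \<and> s \<cdot> q = t"
      using e comp_in_Hom[OF h(2) t] u by metis
  qed (use HomD[OF h(1)] HomD[OF h(4)] h(8) in auto)
  ultimately show ?thesis using that h(1,4) unfolding short_exact_def by blast
qed

lemma kernel_monic: assumes "is_kernel C k f" shows "monic C k"
  unfolding monic_def
proof (intro conjI allI ballI impI)
  show k: "k \<in> Arr C" using assms by (simp add: is_kernel_def)
  fix w g h assume g: "g \<in> Hom C w (Dom C k)" and h: "h \<in> Hom C w (Dom C k)" and e: "k \<cdot> g = k \<cdot> h"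
  have kH: "k \<in> Hom C (Dom C k) (Dom C f)" and fH: "f \<in> Hom C (Dom C f) (Cod C f)"
    and fk: "f \<cdot> k = Zer C (Dom C k) (Cod C f)"
    using assms by (auto simp: is_kernel_def Hom_def)
  have t: "k \<cdot> h \<in> Hom C w (Dom C f)" by (rule comp_in_Hom[OF h kH])
  have "f \<cdot> (k \<cdot> h) = Zer C w (Cod C f)"
    using comp_assoc[OF h kH fH] fk zer_comp[OF h] Hom_obj[OF fH] by simp
  then have "\<exists>!s. s \<in> Hom C w (Dom C k) \<and> k \<cdot> s = k \<cdot> h" using assms t unfolding is_kernel_def by blast
  then show "g = h" using g h e by blast
qed

lemma cokernel_epic: assumes "is_cokernel C q f" shows "epic C q"
  unfolding epic_def
proof (intro conjI allI ballI impI)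
  show k: "q \<in> Arr C" using assms by (simp add: is_cokernel_def)
  fix w g h assume g: "g \<in> Hom C (Cod C q) w" and h: "h \<in> Hom C (Cod C q) w" and e: "g \<cdot> q = h \<cdot> q"
  have qH: "q \<in> Hom C (Cod C f) (Cod C q)" and fH: "f \<in> Hom C (Dom C f) (Cod C f)"
    and qf: "q \<cdot> f = Zer C (Dom C f) (Cod C q)"
    using assms by (auto simp: is_cokernel_def Hom_def)
  have t: "h \<cdot> q \<in> Hom C (Cod C f) w" by (rule comp_in_Hom[OF qH h])
  have "(h \<cdot> q) \<cdot> f = Zer C (Dom C f) w"
    using comp_assoc[OF fH qH h] qf comp_zer[OF h] Hom_obj[OF fH] by simp
  then have "\<exists>!s. s \<in> Hom C (Cod C q) w \<and> s \<cdot> q = h \<cdot> q" using assms t unfolding is_cokernel_def by blast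
  then show "g = h" using g h e by blast
qed

text \<open>As \<open>g \<cdot> k = 0\<close>, the map \<open>g\<close> factors as
  \<open>s \<cdot> q\<close>. Hence whatever \<open>q\<close> kills is killed by \<open>g\<close>,
  and the universal property of \<open>k\<close> for \<open>g\<close> applies.\<close>

lemma kernel_of_cokernel:
  assumes k: "is_kernel C k g" and q: "is_cokernel C q k"
  shows "is_kernel C k q"
  unfolding is_kernel_def
proof (intro conjI allI ballI impI)
  have H: "k \<in> Hom C (Dom C k) (Cod C k)" "q \<in> Hom C (Cod C k) (Cod C q)" "g \<in> Hom C (Cod C k) (Cod C g)"
    using k q by (auto simp: is_kernel_def is_cokernel_def Hom_def)
  obtain s where s: "s \<in> Hom C (Cod C q) (Cod C g)" "s \<cdot> q = g"
    using k q H(3) unfolding is_kernel_def is_cokernel_def by metis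
  fix w t assume t: "t \<in> Hom C w (Dom C q)" and qt: "q \<cdot> t = Zer C w (Cod C q)"
  have t: "t \<in> Hom C w (Cod C k)" using t HomD[OF H(2)] by simp
  have "g \<cdot> t = Zer C w (Cod C g)"
    using comp_assoc[OF t H(2) s(1)] s(2) qt comp_zer[OF s(1)] Hom_obj[OF t] by simp
  then show "\<exists>!s. s \<in> Hom C w (Dom C k) \<and> k \<cdot> s = t"
    using k t unfolding is_kernel_def by auto
qed (use k q in \<open>auto simp: is_kernel_def is_cokernel_def\<close>)

lemma cokernel_of_kernel:
  assumes q: "is_cokernel C q g" and k: "is_kernel C k q"
  shows "is_cokernel C q k"
  unfolding is_cokernel_def
proof (intro conjI allI ballI impI)
  have H: "k \<in> Hom C (Dom C k) (Dom C q)" "q \<in> Hom C (Dom C q) (Cod C q)" "g \<in> Hom C (Dom C g) (Dom C q)"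
    using k q by (auto simp: is_kernel_def is_cokernel_def Hom_def)
  obtain s where s: "s \<in> Hom C (Dom C g) (Dom C k)" "k \<cdot> s = g"
    using k q H(3) unfolding is_kernel_def is_cokernel_def by metis
  fix w t assume t: "t \<in> Hom C (Cod C k) w" and tk: "t \<cdot> k = Zer C (Dom C k) w"
  have t: "t \<in> Hom C (Dom C q) w" using t HomD[OF H(1)] by simp
  have "t \<cdot> g = Zer C (Dom C g) w"
    using comp_assoc[OF s(1) H(1) t] s(2) tk zer_comp[OF s(1)] Hom_obj[OF t] by simp
  then show "\<exists>!s. s \<in> Hom C (Cod C q) w \<and> s \<cdot> q = t"
    using q t unfolding is_cokernel_def by (metis (no_types, lifting))
qed (use k q in \<open>auto simp: is_kernel_def is_cokernel_def\<close>)

end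

section \<open>Image factorization and splitting of idempotents\<close>

context abelian_category
begin

text \<open>A kernel is the kernel of its own cokernel. Short exact sequences are the form in which
  monics of \<open>\<A>c\<close> can be turned into triangles.\<close>

lemma monic_short_exact:
  assumes "monic C m"
  obtains q where "q \<in> Hom C (Cod C m) (Cod C q)" "short_exact C m q"
proof -
  obtain g where g: "is_kernel C m g" using monic_is_kernel[OF assms] by blast
  obtain q where q: "is_cokernel C q m" using ex_cokernel[of m] assms unfolding monic_def by blast
  show ?thesis
  proof (rule that)
    show "q \<in> Hom C (Cod C m) (Cod C q)" using q by (auto simp: is_cokernel_def Hom_def)
    show "short_exact C m q" using kernel_of_cokernel[OF g q] q by (simp add: short_exact_def)
  qed
qed

lemma epic_short_exact:
  assumes "epic C q"
  obtains k where "k \<in> Hom C (Dom C k) (Dom C q)" "short_exact C k q"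
proof -
  obtain g where g: "is_cokernel C q g" using epic_is_cokernel[OF assms] by blast
  obtain k where k: "is_kernel C k q" using ex_kernel[of q] assms unfolding epic_def by blast
  show ?thesis
  proof (rule that)
    show "k \<in> Hom C (Dom C k) (Dom C q)" using k by (auto simp: is_kernel_def Hom_def)
    show "short_exact C k q" using cokernel_of_kernel[OF g k] k by (simp add: short_exact_def)
  qed
qed

text \<open>If \<open>m \<cdot> t = 0\<close>, then \<open>m\<close> factors through \<open>q = coker t\<close>. The epic \<open>q \<cdot> e\<close> is the
  cokernel of some \<open>r\<close>, and \<open>f \<cdot> r = 0\<close> gives \<open>e \<cdot> r = 0\<close>, so \<open>e\<close> factors through \<open>q \<cdot> e\<close>. Hence \<open>q\<close> is
  split monic and \<open>t = 0\<close>.\<close>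

lemma epic_mono_factorization:
  assumes f: "f \<in> Hom C x y"
  obtains w k i e m where "k \<in> Hom C w x" "e \<in> Hom C x i" "m \<in> Hom C i y" "m \<cdot> e = f"
    "short_exact C k e" "epic C e" "monic C m"
proof -
  obtain k where k: "is_kernel C k f" using ex_kernel HomD[OF f] by blast
  then have kA: "k \<in> Hom C (Dom C k) x" and fk: "f \<cdot> k = Zer C (Dom C k) y"
    using HomD[OF f] by (auto simp: is_kernel_def Hom_def)
  obtain e where e: "is_cokernel C e k" using ex_cokernel HomD[OF kA] by blast
  then have eA: "e \<in> Hom C x (Cod C e)" and ek: "e \<cdot> k = Zer C (Dom C k) (Cod C e)"
    using HomD[OF kA] by (auto simp: is_cokernel_def Hom_def)
  define i where "i = Cod C e"
  note eA = eA[folded i_def] and ek = ek[folded i_def]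
  have ep: "epic C e" by (rule cokernel_epic[OF e])
  obtain m where m: "m \<in> Hom C i y" "m \<cdot> e = f"
    using e f fk HomD[OF kA] unfolding is_cokernel_def i_def by metis
  have "monic C m"
    unfolding monic_def
  proof (intro conjI allI ballI impI)
    show "m \<in> Arr C" using HomD[OF m(1)] by simp
    fix w g h assume gh: "g \<in> Hom C w (Dom C m)" "h \<in> Hom C w (Dom C m)" and eq: "m \<cdot> g = m \<cdot> h"
    have g: "g \<in> Hom C w i" and h: "h \<in> Hom C w i" using gh HomD[OF m(1)] by auto
    define t where "t = Sub g h"
    have t: "t \<in> Hom C w i" unfolding t_def using sub_in[OF g h] .
    have mt: "m \<cdot> t = Zer C w y"
      unfolding t_def using comp_sub[OF g h m(1)] eq sub_self[OF comp_in_Hom[OF h m(1)]] by simp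
    obtain q where q: "is_cokernel C q t" using ex_cokernel HomD[OF t] by blast
    then have qA: "q \<in> Hom C i (Cod C q)" and qt: "q \<cdot> t = Zer C w (Cod C q)"
      using HomD[OF t] by (auto simp: is_cokernel_def Hom_def)
    obtain m' where m': "m' \<in> Hom C (Cod C q) y" "m' \<cdot> q = m"
      using q m(1) mt HomD[OF t] unfolding is_cokernel_def by metis
    have qe: "q \<cdot> e \<in> Hom C x (Cod C q)" by (rule comp_in_Hom[OF eA qA])
    obtain r where r: "is_cokernel C (q \<cdot> e) r"
      using epic_is_cokernel[OF epic_comp[OF ep cokernel_epic[OF q] eA qA]] by blast
    then have rA: "r \<in> Hom C (Dom C r) x" and qer: "q \<cdot> e \<cdot> r = Zer C (Dom C r) (Cod C q)"
      using HomD[OF qe] by (auto simp: is_cokernel_def Hom_def)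
    have ro: "Dom C r \<in> Obj C" using Hom_obj[OF rA] by simp
    have fe: "f = m' \<cdot> (q \<cdot> e)" using comp_assoc[OF eA qA m'(1)] m'(2) m(2) by simp
    have "f \<cdot> r = Zer C (Dom C r) y"
      unfolding fe using comp_assoc[OF rA qe m'(1)] qer comp_zer[OF m'(1) ro] by simp
    then obtain r' where r': "r' \<in> Hom C (Dom C r) (Dom C k)" "k \<cdot> r' = r"
      using k rA HomD[OF f] unfolding is_kernel_def by metis
    have io: "i \<in> Obj C" using Hom_obj[OF eA] by simp
    have "e \<cdot> r = Zer C (Dom C r) i"
      using comp_assoc[OF r'(1) kA eA] r'(2) ek zer_comp[OF r'(1) io] by simp
    then obtain s where s: "s \<in> Hom C (Cod C q) i" "s \<cdot> (q \<cdot> e) = e"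
      using r eA HomD[OF rA] HomD[OF qe] unfolding is_cokernel_def by metis
    have "s \<cdot> q = Id C i"
    proof -
      have "(s \<cdot> q) \<cdot> e = Id C i \<cdot> e" using comp_assoc[OF eA qA s(1)] s(2) comp_id_left[OF eA] by simp
      then show ?thesis using ep comp_in_Hom[OF qA s(1)] id_in_Hom[OF io] HomD[OF eA] unfolding epic_def by blast
    qed
    then have "t = s \<cdot> (q \<cdot> t)" using comp_assoc[OF t qA s(1)] comp_id_left[OF t] by simp
    also have "\<dots> = Zer C w i" unfolding qt using comp_zer[OF s(1)] Hom_obj[OF t] by simp
    finally show "g = h" using sub_eq_zer[OF g h] by (simp add: t_def)
  qed
  moreover have "short_exact C k e" using kernel_of_cokernel[OF k e] e by (simp add: short_exact_def)
  ultimately show ?thesis using that kA eA m ep by blast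
qed

lemma idempotent_splits:
  assumes f: "f \<in> Hom C x x" and idem: "f \<cdot> f = f"
  obtains y m e where "m \<in> Hom C y x" "e \<in> Hom C x y" "m \<cdot> e = f" "e \<cdot> m = Id C y" "monic C m"
proof -
  obtain y e m where e: "e \<in> Hom C x y" "epic C e" and m: "m \<in> Hom C y x" "monic C m" and me: "m \<cdot> e = f"
    by (rule epic_mono_factorization[OF f]) blast
  have y: "y \<in> Obj C" using Hom_obj[OF m(1)] by simp
  have em: "e \<cdot> m \<in> Hom C y y" by (rule comp_in_Hom[OF m(1) e(1)])
  \<comment> \<open>This is idempotency of \<open>m \<cdot> e\<close>. Cancelling the monic
    \<open>m\<close> on the left and the epic \<open>e\<close> on the right leaves
    \<open>e \<cdot> m = 1\<close>.\<close>
  have "m \<cdot> ((e \<cdot> m) \<cdot> e) = m \<cdot> e"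
    using idem comp_assoc[OF e(1) m(1) e(1)] comp_assoc[OF comp_in_Hom[OF e(1) m(1)] e(1) m(1)] me by simp
  then have "(e \<cdot> m) \<cdot> e = e"
    using m e(1) comp_in_Hom[OF e(1) em] HomD[OF m(1)] unfolding monic_def by blast
  then have "(e \<cdot> m) \<cdot> e = Id C y \<cdot> e" using comp_id_left[OF e(1)] by simp
  then have "e \<cdot> m = Id C y"
    using e em id_in_Hom[OF y] HomD[OF e(1)] unfolding epic_def by blast
  then show ?thesis using that m e me by blast
qed

end

section \<open>Triangulated categories\<close>

context triangulated_category
begin

section \<open>Exactness, rotation and transport of triangles\<close>

lemma triangleD:
  assumes "triangle T x y z u v w"
  shows "u \<in> Hom T x y" "v \<in> Hom T y z" "w \<in> Hom T z (SObj T x)"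
    "x \<in> Obj T" "y \<in> Obj T" "z \<in> Obj T"
  using assms Hom_obj[of u x y] Hom_obj[of v y z] unfolding triangle_def by auto

lemma susp_neg: assumes "f \<in> Hom T x y" shows "SArr T (Neg T f) = Neg T (SArr T f)"
proof -
  have "Add T (SArr T f) (SArr T (Neg T f)) = Zer T (SObj T x) (SObj T y)"
    using susp_additive[OF assms neg_in[OF assms]] add_neg[OF assms] susp_zer Hom_obj[OF assms] by simp
  from add_eq_zer[OF susp_in[OF assms] susp_in[OF neg_in[OF assms]] this]
  show ?thesis using neg_neg[OF susp_in[OF neg_in[OF assms]]] by simp
qed

text \<open>The triangle \<open>x = x \<rightarrow> 0\<close> maps to the given one by
  \<open>1\<close> and \<open>u\<close>, so \<open>v \<cdot> u\<close> factors through a zero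
  object.\<close>

lemma triangle_comp_zero:
  assumes tr: "triangle T x y z u v w" shows "v \<cdot> u = Zer T x z"
proof -
  note D = triangleD[OF tr]
  obtain n where n: "zero_object T n" using ex_zero_object by blast
  then have no: "n \<in> Obj T" by (simp add: zero_object_def)
  from TR3[OF TR1_id[OF D(4) n] tr id_in_Hom[OF D(4)] D(1) refl]
  obtain h where h: "h \<in> Hom T n z" "h \<cdot> Zer T x n = v \<cdot> u" by blast
  then show ?thesis using comp_zer[OF h(1) D(4)] by simp
qed

lemma zero_object_susp: "zero_object T n \<Longrightarrow> zero_object T (SObj T n)"
  unfolding zero_object_iff using susp_obj susp_id susp_zer by metis

lemma triangle_zero_id:
  assumes s: "s \<in> Obj T" and n: "zero_object T n"
  shows "triangle T n s s (Zer T n s) (Id T s) (Zer T s (SObj T n))"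
proof -
  have no: "n \<in> Obj T" and Sn: "zero_object T (SObj T n)" "SObj T n \<in> Obj T"
    using n zero_object_susp susp_obj by (auto simp: zero_object_def)
  have "Neg T (SArr T (Zer T n s)) = Zer T (SObj T n) (SObj T s)"
    using susp_zer[OF no s] neg_zer[OF Sn(2) susp_obj[OF s]] by simp
  then show ?thesis
    using TR2[OF zer_in[OF no s] id_in_Hom[OF s] zer_in[OF s Sn(2)]] TR1_id[OF s Sn(1)] by simp
qed

text \<open>The dual of \<open>triangle_exact\<close>: \<open>t \<cdot> u = 0\<close> is the square
  needed to map the triangle to \<open>0 \<rightarrow> s = s\<close>, and the third component of
  that morphism is the factorization.\<close>

lemma triangle_coexact:
  assumes tr: "triangle T x y z u v w" and t: "t \<in> Hom T y s" and tu: "t \<cdot> u = Zer T x s"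
  obtains h where "h \<in> Hom T z s" "h \<cdot> v = t"
proof -
  note D = triangleD[OF tr]
  obtain n where n: "zero_object T n" using ex_zero_object by blast
  then have no: "n \<in> Obj T" by (simp add: zero_object_def)
  have s: "s \<in> Obj T" using Hom_obj[OF t] by simp
  have "t \<cdot> u = Zer T n s \<cdot> Zer T x n" using tu comp_zer[OF zer_in[OF no s] D(4)] by simp
  from TR3[OF tr triangle_zero_id[OF s n] zer_in[OF D(4) no] t this]
  obtain h where h: "h \<in> Hom T z s" "h \<cdot> v = Id T s \<cdot> t" by blast
  then show ?thesis using that comp_id_left[OF t] by simp
qed

text \<open>The suspension need not be bijective on objects, so the third vertex must be presented
  as \<open>SObj T x\<close>. Fullness gives a preimage of \<open>t\<close>, and negating it absorbs
  the sign of TR2.\<close>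

lemma triangle_unrotate:
  assumes tr: "triangle T y z (SObj T x) v w t" and x: "x \<in> Obj T"
  obtains u where "triangle T x y z u v w" "t = Neg T (SArr T u)"
proof -
  note D = triangleD[OF tr]
  obtain s where s: "s \<in> Hom T x y" "SArr T s = t" using susp_full[OF x D(4,3)] by blast
  have n: "Neg T (SArr T (Neg T s)) = t"
    using susp_neg[OF s(1)] s(2) neg_neg[OF D(3)] by simp
  show ?thesis
  proof (rule that)
    show "triangle T x y z (Neg T s) v w" using TR2[OF neg_in[OF s(1)] D(1,2)] n tr by simp
  qed (simp add: n)
qed

lemma triangle_transport:
  assumes tr: "triangle T x y z u v w"
    and a: "a \<in> Hom T x x'" "a' \<in> Hom T x' x" "a' \<cdot> a = Id T x" "a \<cdot> a' = Id T x'"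
    and b: "b \<in> Hom T y y'" "b' \<in> Hom T y' y" "b' \<cdot> b = Id T y" "b \<cdot> b' = Id T y'"
    and c: "c \<in> Hom T z z'" "c' \<in> Hom T z' z" "c' \<cdot> c = Id T z" "c \<cdot> c' = Id T z'"
  shows "triangle T x' y' z' (b \<cdot> (u \<cdot> a')) (c \<cdot> (v \<cdot> b')) (SArr T a \<cdot> (w \<cdot> c'))"
proof (rule TR1_iso[OF tr _ _ _ a(1) b(1) c(1) is_isoI[OF a] is_isoI[OF b] is_isoI[OF c]])
  note D = triangleD[OF tr]
  note Sa = susp_in[OF a(1)]
  note ua = comp_in_Hom[OF a(2) D(1)] and vb = comp_in_Hom[OF b(2) D(2)] and wc = comp_in_Hom[OF c(2) D(3)]
  show "b \<cdot> (u \<cdot> a') \<in> Hom T x' y'" by (rule comp_in_Hom[OF ua b(1)])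
  show "c \<cdot> (v \<cdot> b') \<in> Hom T y' z'" by (rule comp_in_Hom[OF vb c(1)])
  show "SArr T a \<cdot> (w \<cdot> c') \<in> Hom T z' (SObj T x')" by (rule comp_in_Hom[OF wc Sa])
  show "b \<cdot> u = b \<cdot> (u \<cdot> a') \<cdot> a"
    using comp_assoc[OF a(1) ua b(1)] comp_assoc[OF a(1,2) D(1)] a(3) comp_id_right[OF D(1)] by simp
  show "c \<cdot> v = c \<cdot> (v \<cdot> b') \<cdot> b"
    using comp_assoc[OF b(1) vb c(1)] comp_assoc[OF b(1,2) D(2)] b(3) comp_id_right[OF D(2)] by simp
  show "SArr T a \<cdot> w = SArr T a \<cdot> (w \<cdot> c') \<cdot> c"
    using comp_assoc[OF c(1) wc Sa] comp_assoc[OF c(1,2) D(3)] c(3) comp_id_right[OF D(3)] by simp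
qed

lemma triangle_isomorphic:
  assumes tr: "triangle T x y z u v w" and "isomorphic T x x'" "isomorphic T y y'" "isomorphic T z z'"
  obtains u' v' w' where "triangle T x' y' z' u' v' w'"
  using assms(2-4) triangle_transport[OF tr] by (metis isomorphicE)

text \<open>Rotating a triangle three times gives its suspension with all three maps negated. Two of
  the signs are removed by the automorphism \<open>-1\<close> of the middle vertex, the third by
  taking \<open>Neg T k\<close> as connecting map.\<close>

lemma triangle_desusp:
  assumes tr: "triangle T (SObj T x) (SObj T y) (SObj T z) f g h" and o: "x \<in> Obj T" "y \<in> Obj T" "z \<in> Obj T"
  obtains f' g' h' where "triangle T x y z f' g' h'" "SArr T f' = f" "SArr T g' = g"
proof -
  note D = triangleD[OF tr]
  obtain f' where f': "f' \<in> Hom T x y" "SArr T f' = f" using susp_full[OF o(1,2) D(1)] by blast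
  obtain g' where g': "g' \<in> Hom T y z" "SArr T g' = g" using susp_full[OF o(2,3) D(2)] by blast
  obtain k where k: "k \<in> Hom T z (SObj T x)" "SArr T k = h" using susp_full[OF o(3) D(4,3)] by blast
  note nk = neg_in[OF k(1)]
  let ?i = "Id T (SObj T y)"
  note i = id_in_Hom[OF D(5)]
  have "triangle T (SObj T x) (SObj T y) (SObj T z) (Neg T f) (Neg T g) h"
  proof (rule TR1_iso[OF tr neg_in[OF D(1)] neg_in[OF D(2)] D(3) id_in_Hom[OF D(4)] neg_in[OF i]
        id_in_Hom[OF D(6)] is_iso_id[OF D(4)] _ is_iso_id[OF D(6)]])
    have "Neg T ?i \<cdot> Neg T ?i = ?i" using neg_neg_comp[OF i i] comp_id_left[OF i] by simp
    then show "is_iso T (Neg T ?i)" using is_isoI[OF neg_in[OF i] neg_in[OF i]] by simp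
    show "Neg T ?i \<cdot> f = Neg T f \<cdot> Id T (SObj T x)"
      using neg_comp[OF D(1) i] comp_id_left[OF D(1)] comp_id_right[OF neg_in[OF D(1)]] by simp
    show "Id T (SObj T z) \<cdot> g = Neg T g \<cdot> Neg T ?i"
      using neg_neg_comp[OF i D(2)] comp_id_left[OF D(2)] comp_id_right[OF D(2)] by simp
    show "SArr T (Id T (SObj T x)) \<cdot> h = h \<cdot> Id T (SObj T z)"
      using susp_id[OF D(4)] comp_id_left[OF D(3)] comp_id_right[OF D(3)] by simp
  qed
  moreover have "SArr T (Neg T k) = Neg T h" using susp_neg[OF k(1)] k(2) by simp
  then have "Neg T (SArr T (Neg T k)) = h" using neg_neg[OF D(3)] by simp
  ultimately have "triangle T x y z f' g' (Neg T k)"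
    using TR2[OF f'(1) g'(1) nk] TR2[OF g'(1) nk neg_in[OF susp_in[OF f'(1)]]]
      TR2[OF nk neg_in[OF susp_in[OF f'(1)]] neg_in[OF susp_in[OF g'(1)]]] f'(2) g'(2) by simp
  then show ?thesis using that f' g' by blast
qed

lemma triangle_susp:
  assumes "triangle T x y z u v w"
  obtains u' v' w' where "triangle T (SObj T x) (SObj T y) (SObj T z) u' v' w'"
  using triangle_rotate[OF triangle_rotate[OF triangle_rotate[OF assms]]] by blast

text \<open>The cone of \<open>h\<close> is a suspension only up to isomorphism, so the triangle is
  first transported to one with third vertex \<open>SObj T x\<close> and then rotated back.\<close>

lemma ex_fibre:
  assumes h: "h \<in> Hom T y z"
  obtains x u w where "triangle T x y z u h w"
proof -
  obtain k v w where tr: "triangle T y z k h v w" using TR1_ex[OF h] by blast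
  note D = triangleD[OF tr]
  obtain x where x: "x \<in> Obj T" "isomorphic T (SObj T x) k" using susp_ess_surj[OF D(6)] by blast
  obtain e e' where e: "e \<in> Hom T k (SObj T x)" "e' \<in> Hom T (SObj T x) k"
    "e' \<cdot> e = Id T k" "e \<cdot> e' = Id T (SObj T x)" using x(2) by (metis isomorphicE)
  note iy = id_in_Hom[OF D(4)] and iz = id_in_Hom[OF D(5)]
  have "triangle T y z (SObj T x) h (e \<cdot> v) (w \<cdot> e')"
    using triangle_transport[OF tr iy iy _ _ iz iz _ _ e] comp_id_left[OF iy] comp_id_left[OF iz]
      comp_id_right[OF D(1)] comp_id_left[OF D(1)] comp_id_right[OF D(2)] susp_id[OF D(4)]
      comp_id_left[OF comp_in_Hom[OF e(2) D(3)]] by simp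
  then show ?thesis using that triangle_unrotate x(1) by metis
qed

lemma ex_extension:
  assumes h: "h \<in> Hom T z (SObj T x)" and x: "x \<in> Obj T"
  obtains y u v where "triangle T x y z u v h"
proof -
  obtain y u w where "triangle T y z (SObj T x) u h w" by (rule ex_fibre[OF h])
  then show ?thesis using that triangle_unrotate x by metis
qed

text \<open>The difference \<open>d = h - 1\<close> kills \<open>v\<close>, so it factors through \<open>w\<close>; as \<open>w \<cdot> d = 0\<close>, it squares to zero and
  \<open>1 - d\<close> inverts \<open>h\<close>.\<close>

lemma triangle_endo_split:
  assumes tr: "triangle T x y z u v w" and h: "h \<in> Hom T z z" "h \<cdot> v = v" "w \<cdot> h = w"
  obtains k where "k \<in> Hom T z z" "k \<cdot> h = Id T z"
proof -
  note D = triangleD[OF tr]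
  note i = id_in_Hom[OF D(6)]
  define d where "d = Sub h (Id T z)"
  have d: "d \<in> Hom T z z" unfolding d_def by (rule sub_in[OF h(1) i])
  have dv: "d \<cdot> v = Zer T y z"
    unfolding d_def using sub_comp[OF D(2) h(1) i] h(2) comp_id_left[OF D(2)] sub_self[OF D(2)] by simp
  have wd: "w \<cdot> d = Zer T z (SObj T x)"
    unfolding d_def using comp_sub[OF h(1) i D(3)] h(3) comp_id_right[OF D(3)] sub_self[OF D(3)] by simp
  obtain k where k: "k \<in> Hom T (SObj T x) z" "k \<cdot> w = d"
    by (rule triangle_coexact[OF triangle_rotate[OF tr] d dv])
  have "d \<cdot> d = Zer T z z" using comp_assoc[OF d D(3) k(1)] k(2) wd comp_zer[OF k(1) D(6)] by simp
  moreover have "d \<cdot> d = Sub (d \<cdot> h) d" using comp_sub[OF h(1) i d] comp_id_right[OF d] by (simp add: d_def)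
  ultimately have dh: "d \<cdot> h = d" using sub_eq_zer[OF comp_in_Hom[OF h(1) d] d] by simp
  show ?thesis
  proof (rule that)
    show "Sub (Id T z) d \<in> Hom T z z" by (rule sub_in[OF i d])
    show "Sub (Id T z) d \<cdot> h = Id T z"
      using sub_comp[OF h(1) i d] comp_id_left[OF h(1)] dh sub_sub[OF h(1) i] by (simp add: d_def)
  qed
qed

text \<open>TR3 extends \<open>(i, j)\<close> and \<open>(p, q)\<close> to the third vertices by
  \<open>g\<close> and \<open>h\<close>. The composite \<open>h \<cdot> g\<close> need not be
  \<open>1\<close>, but it is compatible with \<open>v\<close> and \<open>w\<close>, so
  \<open>triangle_endo_split\<close> gives a left inverse \<open>k\<close>, and
  \<open>k \<cdot> h\<close> is the retraction.\<close>

lemma triangle_retract: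
  assumes tr: "triangle T x y z u v w" and tr': "triangle T x' y' z' u' v' w'"
    and i: "i \<in> Hom T x x'" and p: "p \<in> Hom T x' x" and pi: "p \<cdot> i = Id T x"
    and j: "j \<in> Hom T y y'" and q: "q \<in> Hom T y' y" and qj: "q \<cdot> j = Id T y"
    and ju: "j \<cdot> u = u' \<cdot> i" and qu: "q \<cdot> u' = u \<cdot> p"
  shows "retract T z z'"
proof -
  note D = triangleD[OF tr] and D' = triangleD[OF tr']
  obtain g where g: "g \<in> Hom T z z'" "g \<cdot> v = v' \<cdot> j" "SArr T i \<cdot> w = w' \<cdot> g"
    using TR3[OF tr tr' i j ju] by blast
  obtain h where h: "h \<in> Hom T z' z" "h \<cdot> v' = v \<cdot> q" "SArr T p \<cdot> w' = w \<cdot> h"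
    using TR3[OF tr' tr p q qu] by blast
  have 1: "(h \<cdot> g) \<cdot> v = v"
    using comp_assoc[OF D(2) g(1) h(1)] g(2) comp_assoc[OF j D'(2) h(1)] h(2) comp_assoc[OF j q D(2)]
      qj comp_id_right[OF D(2)] by simp
  have 2: "w \<cdot> (h \<cdot> g) = w"
    using comp_assoc[OF g(1) h(1) D(3)] h(3) comp_assoc[OF g(1) D'(3) susp_in[OF p]] g(3)
      comp_assoc[OF D(3) susp_in[OF i] susp_in[OF p]] susp_comp[OF i p] pi susp_id[OF D(4)]
      comp_id_left[OF D(3)] by simp
  obtain k where k: "k \<in> Hom T z z" "k \<cdot> (h \<cdot> g) = Id T z"
    by (rule triangle_endo_split[OF tr comp_in_Hom[OF g(1) h(1)] 1 2])
  then have "(k \<cdot> h) \<cdot> g = Id T z" using comp_assoc[OF g(1) h(1) k(1)] by simp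
  then show ?thesis using g(1) comp_in_Hom[OF h(1) k(1)] unfolding retract_def by blast
qed

text \<open>Complete the split monic \<open>j\<close> to a triangle. Its suspension is again split
  monic and composes with \<open>w\<close> to zero, so \<open>w = 0\<close>. The cone
  \<open>z\<close> is then the complement, with section \<open>s\<close> coming from
  \<open>1 - j \<cdot> r\<close>, which vanishes on \<open>j\<close>.\<close>

lemma retract_direct_sum:
  assumes "retract T x y"
  obtains z where "direct_sum T y x z"
proof -
  obtain j r where j: "j \<in> Hom T x y" and r: "r \<in> Hom T y x" and rj: "r \<cdot> j = Id T x"
    using assms unfolding retract_def by blast
  obtain z q w where tr: "triangle T x y z j q w" using TR1_ex[OF j] by blast
  note D = triangleD[OF tr]
  note Sj = susp_in[OF j] and Sr = susp_in[OF r]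
  have "Neg T (SArr T j) \<cdot> w = Zer T z (SObj T y)"
    by (rule triangle_comp_zero[OF triangle_rotate[OF triangle_rotate[OF tr]]])
  then have "Neg T (SArr T j \<cdot> w) = Neg T (Zer T z (SObj T y))"
    using neg_comp[OF D(3) Sj] neg_zer[OF D(6) susp_obj[OF D(5)]] by simp
  then have "SArr T j \<cdot> w = Zer T z (SObj T y)"
    using neg_inj[OF comp_in_Hom[OF D(3) Sj] zer_in[OF D(6) susp_obj[OF D(5)]]] by simp
  then have w: "w = Zer T z (SObj T x)"
    using comp_assoc[OF D(3) Sj Sr] susp_comp[OF j r] rj susp_id[OF D(4)] comp_id_left[OF D(3)]
      comp_zer[OF Sr D(6)] by simp
  \<comment> \<open>Two maps that agree after \<open>q\<close> differ by a map that factors through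
    \<open>w = 0\<close>.\<close>
  have epi: "k = l" if k: "k \<in> Hom T z t" and l: "l \<in> Hom T z t" and e: "k \<cdot> q = l \<cdot> q" for k l t
  proof -
    note kl = sub_in[OF k l]
    have "Sub k l \<cdot> q = Zer T y t"
      using sub_comp[OF D(2) k l] e sub_self[OF comp_in_Hom[OF D(2) l]] by simp
    then obtain m where m: "m \<in> Hom T (SObj T x) t" "m \<cdot> w = Sub k l"
      by (rule triangle_coexact[OF triangle_rotate[OF tr] kl])
    then have "Sub k l = Zer T z t" using comp_zer[OF m(1) D(6)] w by simp
    then show ?thesis by (rule sub_eq_zer[OF k l])
  qed
  note iy = id_in_Hom[OF D(5)] and iz = id_in_Hom[OF D(6)]
  note jr = comp_in_Hom[OF r j]
  have jrj: "(j \<cdot> r) \<cdot> j = j" using comp_assoc[OF j r j] rj comp_id_right[OF j] by simp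
  have "Sub (Id T y) (j \<cdot> r) \<cdot> j = Zer T x y"
    using sub_comp[OF j iy jr] comp_id_left[OF j] jrj sub_self[OF j] by simp
  then obtain s where s: "s \<in> Hom T z y" "s \<cdot> q = Sub (Id T y) (j \<cdot> r)"
    by (rule triangle_coexact[OF tr sub_in[OF iy jr]])
  have qj: "q \<cdot> j = Zer T x z" by (rule triangle_comp_zero[OF tr])
  have "(q \<cdot> s) \<cdot> q = Sub q (q \<cdot> (j \<cdot> r))"
    using comp_assoc[OF D(2) s(1) D(2)] s(2) comp_sub[OF iy jr D(2)] comp_id_right[OF D(2)] by simp
  also have "q \<cdot> (j \<cdot> r) = Zer T y z" using comp_assoc[OF r j D(2)] qj zer_comp[OF r D(6)] by simp
  finally have "(q \<cdot> s) \<cdot> q = Id T z \<cdot> q" using sub_zer[OF D(2)] comp_id_left[OF D(2)] by simp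
  then have qs: "q \<cdot> s = Id T z" by (rule epi[OF comp_in_Hom[OF s(1) D(2)] iz])
  have "(r \<cdot> s) \<cdot> q = Sub r (r \<cdot> (j \<cdot> r))"
    using comp_assoc[OF D(2) s(1) r] s(2) comp_sub[OF iy jr r] comp_id_right[OF r] by simp
  also have "r \<cdot> (j \<cdot> r) = r" using comp_assoc[OF r j r] rj comp_id_left[OF r] by simp
  finally have "(r \<cdot> s) \<cdot> q = Zer T z x \<cdot> q" using sub_self[OF r] zer_comp[OF D(2,4)] by simp
  then have rs: "r \<cdot> s = Zer T z x" by (rule epi[OF comp_in_Hom[OF s(1) r] zer_in[OF D(6,4)]])
  have "Add T (j \<cdot> r) (s \<cdot> q) = Id T y" unfolding s(2) by (rule add_sub[OF iy jr])
  then have "direct_sum T y x z"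
    unfolding direct_sum_def using D(2,4-6) j r rj s(1) qs rs qj by blast
  then show ?thesis by (rule that)
qed

lemma summand_closed_retract:
  "\<lbrakk>summand_closed T X; y \<in> X; retract T x y\<rbrakk> \<Longrightarrow> x \<in> X"
  by (metis retract_direct_sum summand_closed_def)

text \<open>The identity of \<open>\<Sigma>x\<close> kills the zero connecting map, so it factors
  through the next map \<open>Neg T (SArr T u)\<close>. Desuspending the factor gives a retraction
  for \<open>Neg T u\<close>.\<close>

lemma triangle_zero_split:
  assumes tr: "triangle T x y z u v (Zer T z (SObj T x))"
  shows "retract T x y"
proof -
  note D = triangleD[OF tr]
  note Sx = susp_obj[OF D(4)]
  note i = id_in_Hom[OF Sx]
  have "Id T (SObj T x) \<cdot> Zer T z (SObj T x) = Zer T z (SObj T x)" by (rule comp_zer[OF i D(6)])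
  then obtain h where h: "h \<in> Hom T (SObj T y) (SObj T x)" "h \<cdot> Neg T (SArr T u) = Id T (SObj T x)"
    by (rule triangle_coexact[OF triangle_rotate[OF triangle_rotate[OF tr]] i])
  obtain k where k: "k \<in> Hom T y x" "SArr T k = h" using susp_full[OF D(5,4) h(1)] by blast
  note nu = neg_in[OF D(1)]
  have "SArr T (k \<cdot> Neg T u) = SArr T (Id T x)"
    using susp_comp[OF nu k(1)] susp_neg[OF D(1)] k(2) h(2) susp_id[OF D(4)] by simp
  then have "k \<cdot> Neg T u = Id T x" by (rule susp_inj[OF comp_in_Hom[OF nu k(1)] id_in_Hom[OF D(4)]])
  then show ?thesis using nu k(1) unfolding retract_def by blast
qed

lemma retract_desusp:
  assumes "retract T (SObj T x) (SObj T y)" "x \<in> Obj T" "y \<in> Obj T"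
  shows "retract T x y"
proof -
  obtain i p where ip: "i \<in> Hom T (SObj T x) (SObj T y)" "p \<in> Hom T (SObj T y) (SObj T x)"
    "p \<cdot> i = Id T (SObj T x)" using assms(1) unfolding retract_def by blast
  obtain j where j: "j \<in> Hom T x y" "SArr T j = i" using susp_full[OF assms(2,3) ip(1)] by blast
  obtain q where q: "q \<in> Hom T y x" "SArr T q = p" using susp_full[OF assms(3,2) ip(2)] by blast
  have "SArr T (q \<cdot> j) = SArr T (Id T x)" using susp_comp[OF j(1) q(1)] j(2) q(2) ip(3) susp_id[OF assms(2)] by simp
  then have "q \<cdot> j = Id T x" by (rule susp_inj[OF comp_in_Hom[OF j(1) q(1)] id_in_Hom[OF assms(2)]])
  then show ?thesis using j(1) q(1) unfolding retract_def by blast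
qed

lemma isomorphic_desusp:
  assumes "isomorphic T (SObj T x) (SObj T y)" "x \<in> Obj T" "y \<in> Obj T"
  shows "isomorphic T x y"
proof -
  obtain i p where ip: "i \<in> Hom T (SObj T x) (SObj T y)" "p \<in> Hom T (SObj T y) (SObj T x)"
    "p \<cdot> i = Id T (SObj T x)" "i \<cdot> p = Id T (SObj T y)" by (rule isomorphicE[OF assms(1)])
  obtain j where j: "j \<in> Hom T x y" "SArr T j = i" using susp_full[OF assms(2,3) ip(1)] by blast
  obtain q where q: "q \<in> Hom T y x" "SArr T q = p" using susp_full[OF assms(3,2) ip(2)] by blast
  have "SArr T (q \<cdot> j) = SArr T (Id T x)" using susp_comp[OF j(1) q(1)] j(2) q(2) ip(3) susp_id[OF assms(2)] by simp
  then have 1: "q \<cdot> j = Id T x" by (rule susp_inj[OF comp_in_Hom[OF j(1) q(1)] id_in_Hom[OF assms(2)]])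
  have "SArr T (j \<cdot> q) = SArr T (Id T y)" using susp_comp[OF q(1) j(1)] j(2) q(2) ip(4) susp_id[OF assms(3)] by simp
  then have 2: "j \<cdot> q = Id T y" by (rule susp_inj[OF comp_in_Hom[OF q(1) j(1)] id_in_Hom[OF assms(3)]])
  show ?thesis by (rule isomorphicI[OF j(1) q(1) 1 2])
qed

lemma retract_susp:
  assumes "retract T x y" "x \<in> Obj T" shows "retract T (SObj T x) (SObj T y)"
  using assms susp_in susp_comp susp_id unfolding retract_def by metis

section \<open>The star product and its behaviour under suspension\<close>

lemma triangle_star: "\<lbrakk>triangle T x y z u v w; x \<in> X; z \<in> Y\<rbrakk> \<Longrightarrow> y \<in> star T X Y"
  unfolding star_def using triangleD(5) by blast

lemma starE:
  assumes "z \<in> star T X Y"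
  obtains x y u v w where "x \<in> X" "y \<in> Y" "triangle T x z y u v w"
  using assms unfolding star_def by blast

lemma star_mono: "\<lbrakk>X \<subseteq> X'; Y \<subseteq> Y'\<rbrakk> \<Longrightarrow> star T X Y \<subseteq> star T X' Y'"
  unfolding star_def by blast

text \<open>Each inclusion is one octahedron: on \<open>x \<rightarrow> p \<rightarrow> c\<close>,
  whose cone \<open>t\<close> is an extension of \<open>z\<close> by \<open>y\<close>, and on
  \<open>c \<rightarrow> p \<rightarrow> z\<close>, whose fibre \<open>t\<close> is, after
  desuspension, an extension of \<open>y\<close> by \<open>x\<close>.\<close>

lemma star_assoc: "star T (star T X Y) Z = star T X (star T Y Z)"
proof
  show "star T (star T X Y) Z \<subseteq> star T X (star T Y Z)"
  proof
    fix c assume "c \<in> star T (star T X Y) Z"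
    then obtain p z a b d where z: "z \<in> Z" and 1: "triangle T p c z a b d" and "p \<in> star T X Y" by (metis starE)
    then obtain x y e f g where x: "x \<in> X" "y \<in> Y" and 2: "triangle T x p y e f g" by (metis starE)
    obtain t k k' where 3: "triangle T x c t (a \<cdot> e) k k'"
      using TR1_ex[OF comp_in_Hom[OF triangleD(1)[OF 2] triangleD(1)[OF 1]]] by blast
    from TR4[OF 2 1 3] obtain l m n where "triangle T y t z l m n" by blast
    then have "t \<in> star T Y Z" using triangle_star x z by blast
    then show "c \<in> star T X (star T Y Z)" using triangle_star[OF 3 x(1)] by blast
  qed
  show "star T X (star T Y Z) \<subseteq> star T (star T X Y) Z"
  proof
    fix c assume "c \<in> star T X (star T Y Z)"
    then obtain x p a b d where x: "x \<in> X" and 1: "triangle T x c p a b d" and "p \<in> star T Y Z" by (metis starE)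
    then obtain y z e f g where y: "y \<in> Y" "z \<in> Z" and 2: "triangle T y p z e f g" by (metis starE)
    obtain t k k' where 3: "triangle T t c z k (f \<cdot> b) k'"
      by (rule ex_fibre[OF comp_in_Hom[OF triangleD(2)[OF 1] triangleD(2)[OF 2]]])
    from TR4[OF triangle_rotate[OF 1] triangle_rotate[OF 2] triangle_rotate[OF 3]]
    obtain l m n where "triangle T (SObj T x) (SObj T t) (SObj T y) l m n" by blast
    then obtain l' m' n' where "triangle T x t y l' m' n'"
      using triangle_desusp triangleD(4)[OF 1] triangleD(4)[OF 2] triangleD(4)[OF 3] by metis
    then have "t \<in> star T X Y" using triangle_star x y by blast
    then show "c \<in> star T (star T X Y) Z" using triangle_star[OF 3 _ y(2)] by blast
  qed
qed

lemma in_suspI: "\<lbrakk>isomorphic T z (SObj T x); x \<in> X\<rbrakk> \<Longrightarrow> z \<in> susp T X"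
  unfolding susp_def using isomorphic_obj by blast

lemma SObj_in_susp: "\<lbrakk>x \<in> X; x \<in> Obj T\<rbrakk> \<Longrightarrow> SObj T x \<in> susp T X"
  by (rule in_suspI[OF isomorphic_refl[OF susp_obj]])

lemma susp_mono: "X \<subseteq> Y \<Longrightarrow> susp T X \<subseteq> susp T Y"
  unfolding susp_def by blast

lemma star_suspE:
  assumes "c \<in> star T (susp T X) Y" "X \<subseteq> Obj T"
  obtains x y u v w where "x \<in> X" "y \<in> Y" "triangle T (SObj T x) c y u v w"
proof -
  obtain s y u v w where s: "s \<in> susp T X" and y: "y \<in> Y" and tr: "triangle T s c y u v w"
    by (rule starE[OF assms(1)])
  obtain x where x: "x \<in> X" "isomorphic T s (SObj T x)" using s unfolding susp_def by blast
  from triangle_isomorphic[OF tr x(2) isomorphic_refl isomorphic_refl] triangleD(5,6)[OF tr]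
  show ?thesis using that x(1) y by metis
qed

text \<open>Both ends of the triangle are suspensions up to isomorphism, and so is the middle once
  \<open>e\<close> with \<open>\<Sigma>e \<cong> c\<close> is chosen; the whole triangle can then be
  desuspended.\<close>

lemma susp_star_susp: "X \<subseteq> Obj T \<Longrightarrow> star T (susp T X) (susp T X) \<subseteq> susp T (star T X X)"
proof
  fix c assume XO: "X \<subseteq> Obj T" and "c \<in> star T (susp T X) (susp T X)"
  then obtain x s u v w where x: "x \<in> X" and s: "s \<in> susp T X" and tr: "triangle T (SObj T x) c s u v w"
    by (metis star_suspE)
  obtain y where y: "y \<in> X" "isomorphic T s (SObj T y)" using s unfolding susp_def by blast
  note D = triangleD[OF tr]
  obtain e where e: "e \<in> Obj T" "isomorphic T (SObj T e) c" using susp_ess_surj[OF D(5)] by blast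
  have o: "x \<in> Obj T" "y \<in> Obj T" using x y XO by auto
  obtain u' v' w' where "triangle T (SObj T x) (SObj T e) (SObj T y) u' v' w'"
    by (rule triangle_isomorphic[OF tr isomorphic_refl[OF D(4)] isomorphic_sym[OF e(2)] y(2)])
  then obtain u'' v'' w'' where "triangle T x e y u'' v'' w''"
    using triangle_desusp[OF _ o(1) e(1) o(2)] by metis
  then have "e \<in> star T X X" using triangle_star x y(1) by blast
  then show "c \<in> susp T (star T X X)" by (rule in_suspI[OF isomorphic_sym[OF e(2)]])
qed

end

section \<open>Extension closed proper abelian subcategories\<close>

locale proper_abelian_setting = triangulated_category T
  for T :: "('o, 'm, 'z) tri_data_scheme" (structure) +
  fixes \<A> :: "'o set"
  assumes proper: "proper_abelian_subcategory T \<A>"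
    and ext_closed: "extension_closed T \<A>"
    and Hom_van: "\<And>i. i \<in> {1, 2} \<Longrightarrow> Hom_vanishes T \<A> (desusp T i \<A>)"
begin

abbreviation "\<A>c \<equiv> full_subcat T \<A>"

lemma A_obj: "\<A> \<subseteq> Obj T"
  and A_iso: "\<lbrakk>x \<in> \<A>; isomorphic T x y\<rbrakk> \<Longrightarrow> y \<in> \<A>"
  and A_zero: "zero_object T z \<Longrightarrow> z \<in> \<A>"
  and A_summand: "summand_closed T \<A>"
  using proper isomorphic_obj unfolding proper_abelian_subcategory_def additive_subcategory_def by blast+

lemma A_retract: "\<lbrakk>x \<in> \<A>; retract T y x\<rbrakk> \<Longrightarrow> y \<in> \<A>"
  using summand_closed_retract A_summand by blast

sublocale ab: abelian_category \<A>c
  using proper by (simp add: proper_abelian_subcategory_def)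

lemma short_exact_triangle:
  assumes "short_exact \<A>c f g" "f \<in> Hom \<A>c a b" "g \<in> Hom \<A>c b c"
  obtains h where "triangle T a b c f g h"
  using assms proper unfolding proper_abelian_subcategory_def Hom_full_subcat by blast

lemma triangle_short_exact:
  assumes "triangle T a b c f g h" "a \<in> \<A>" "b \<in> \<A>" "c \<in> \<A>"
  shows "short_exact \<A>c f g"
  using assms proper triangleD(1,2)[OF assms(1)] unfolding proper_abelian_subcategory_def by blast

section \<open>Unique lifting, cones of maps in \<A>, and minimal approximations\<close>

lemma Hom_susp_A:
  assumes "t \<in> susp T \<A>" "a \<in> \<A>"
  shows "Hom T t a = {Zer T t a}" "Hom T (SObj T t) a = {Zer T (SObj T t) a}"
  by (rule Hom_susp_vanish[OF A_obj _ assms], rule Hom_van, assumption)+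

lemma triangle_lift:
  assumes tr: "triangle T x c y u v w" and y: "y \<in> \<A>" and t: "t \<in> susp T \<A>" and g: "g \<in> Hom T t c"
  obtains h where "h \<in> Hom T t x" "u \<cdot> h = g"
proof -
  have "v \<cdot> g = Zer T t y" using Hom_susp_A(1)[OF t y] comp_in_Hom[OF g triangleD(2)[OF tr]] by blast
  from triangle_exact[OF tr g this] show ?thesis using that by blast
qed

text \<open>The suspended difference of two lifts factors through a map
  \<open>\<Sigma>t \<rightarrow> y\<close>, which vanishes; this is where the vanishing condition
  for \<open>i = 2\<close> enters.\<close>

lemma triangle_lift_unique:
  assumes tr: "triangle T x c y u v w" and y: "y \<in> \<A>" and t: "t \<in> susp T \<A>"
    and h: "h \<in> Hom T t x" and k: "k \<in> Hom T t x" and e: "u \<cdot> h = u \<cdot> k"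
  shows "h = k"
proof -
  note u = triangleD(1)[OF tr]
  have "u \<cdot> Sub h k = Zer T t c" using comp_sub[OF h k u] e sub_self[OF comp_in_Hom[OF k u]] by simp
  from triangle_mono[OF tr sub_in[OF h k] this Hom_susp_A(2)[OF t y]]
  show ?thesis by (rule sub_eq_zer[OF h k])
qed

text \<open>With \<open>f = m \<cdot> e\<close> through the image, the octahedral axiom combines the
  cone of \<open>e\<close>, the suspended kernel, with the cone of \<open>m\<close>, the cokernel.
  The singleton records which kernel occurs, so that closure under subobjects can be applied to
  it.\<close>

lemma cone_in_susp_kernel_star:
  assumes tr: "triangle T x y z f v w" and x: "x \<in> \<A>" and y: "y \<in> \<A>"
  obtains k m where "k \<in> \<A>" "z \<in> star T (susp T {k}) \<A>" "monic \<A>c m" "Dom T m = k" "Cod T m = x"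
proof -
  have "f \<in> Hom \<A>c x y" using triangleD(1)[OF tr] x y by (simp add: Hom_full_subcat)
  then obtain n k i e m where k: "k \<in> Hom \<A>c n x" and e: "e \<in> Hom \<A>c x i" and m: "m \<in> Hom \<A>c i y"
    and me: "m \<cdot> e = f" and se: "short_exact \<A>c k e" and mm: "monic \<A>c m"
    by (rule ab.epic_mono_factorization) auto
  obtain h where 1: "triangle T n x i k e h" by (rule short_exact_triangle[OF se k e])
  obtain q where q: "q \<in> Hom \<A>c (Cod \<A>c m) (Cod \<A>c q)" "short_exact \<A>c m q"
    by (rule ab.monic_short_exact[OF mm])
  have "q \<in> Hom \<A>c y (Cod T q)" using q(1) HomD[OF m] by simp
  then obtain h' where 2: "triangle T i y (Cod T q) m q h'" by (rule short_exact_triangle[OF q(2) m])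
  have 3: "triangle T x y z (m \<cdot> e) v w" using tr me by simp
  have n: "n \<in> \<A>" using k by (simp add: Hom_full_subcat)
  have c: "Cod T q \<in> \<A>" using q(1) by (simp add: Hom_full_subcat)
  from TR4[OF triangle_rotate[OF 1] 2 3] obtain a b d where "triangle T (SObj T n) z (Cod T q) a b d" by blast
  moreover have "SObj T n \<in> susp T {n}" using SObj_in_susp A_obj n by blast
  ultimately have z: "z \<in> star T (susp T {n}) \<A>" using triangle_star c by blast
  have "is_kernel \<A>c k e" using se by (simp add: short_exact_def)
  then have "monic \<A>c k" by (rule ab.kernel_monic)
  then show ?thesis using that[OF n z] HomD[OF k] by simp
qed

text \<open>The maps \<open>u\<close> and \<open>\<psi>\<close> factor through each other by
  \<open>g\<close> and \<open>h\<close>. Unique lifting along \<open>u\<close> gives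
  \<open>h \<cdot> g = 1\<close>; hence \<open>g \<cdot> h\<close> is idempotent, and minimality
  makes it an isomorphism, so it is \<open>1\<close> as well.\<close>

lemma approximation_isomorphic:
  assumes tr: "triangle T (SObj T a) c y u v w" and a: "a \<in> \<A>" and y: "y \<in> \<A>"
    and ap: "minimal_right_approximation T (susp T \<A>) c (SObj T b) \<psi>" and b: "b \<in> \<A>"
  shows "isomorphic T a b"
proof -
  have o: "a \<in> Obj T" "b \<in> Obj T" using a b A_obj by auto
  have Sa: "SObj T a \<in> susp T \<A>" and Sb: "SObj T b \<in> susp T \<A>" using SObj_in_susp a b o by auto
  have \<psi>: "\<psi> \<in> Hom T (SObj T b) c"
    and ra: "\<And>t f. \<lbrakk>t \<in> susp T \<A>; f \<in> Hom T t c\<rbrakk> \<Longrightarrow> \<exists>g \<in> Hom T t (SObj T b). \<psi> \<cdot> g = f"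
    and mi: "\<And>e. \<lbrakk>e \<in> Hom T (SObj T b) (SObj T b); \<psi> \<cdot> e = \<psi>\<rbrakk> \<Longrightarrow> is_iso T e"
    using ap unfolding minimal_right_approximation_def right_approximation_def by auto
  note u = triangleD(1)[OF tr]
  obtain g where g: "g \<in> Hom T (SObj T a) (SObj T b)" "\<psi> \<cdot> g = u" using ra[OF Sa u] by blast
  obtain h where h: "h \<in> Hom T (SObj T b) (SObj T a)" "u \<cdot> h = \<psi>" by (rule triangle_lift[OF tr y Sb \<psi>])
  have "u \<cdot> (h \<cdot> g) = u \<cdot> Id T (SObj T a)"
    using comp_assoc[OF g(1) h(1) u] h(2) g(2) comp_id_right[OF u] by simp
  then have hg: "h \<cdot> g = Id T (SObj T a)"
    by (rule triangle_lift_unique[OF tr y Sa comp_in_Hom[OF g(1) h(1)] id_in_Hom[OF susp_obj[OF o(1)]]])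
  note gh = comp_in_Hom[OF h(1) g(1)]
  have "\<psi> \<cdot> (g \<cdot> h) = \<psi>" using comp_assoc[OF h(1) g(1) \<psi>] g(2) h(2) by simp
  then have "is_iso T (g \<cdot> h)" by (rule mi[OF gh])
  then obtain k where k: "k \<in> Hom T (SObj T b) (SObj T b)" "(g \<cdot> h) \<cdot> k = Id T (SObj T b)"
    using HomD[OF gh] unfolding is_iso_def by auto
  have ghg: "(g \<cdot> h) \<cdot> g = g" using comp_assoc[OF g(1) h(1) g(1)] hg comp_id_right[OF g(1)] by simp
  have "g \<cdot> h = (g \<cdot> h) \<cdot> ((g \<cdot> h) \<cdot> k)" using k(2) comp_id_right[OF gh] by simp
  also have "\<dots> = (g \<cdot> h) \<cdot> k"
    using comp_assoc[OF k(1) gh gh] comp_assoc[OF h(1) g(1) gh] ghg by simp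
  also have "\<dots> = Id T (SObj T b)" by (rule k(2))
  finally have "g \<cdot> h = Id T (SObj T b)" .
  then have "isomorphic T (SObj T a) (SObj T b)" by (rule isomorphicI[OF g(1) h(1) hg])
  then show ?thesis by (rule isomorphic_desusp[OF _ o])
qed

section \<open>From torsion-free classes to intermediate categories\<close>

lemma torsion_free_class_props:
  assumes "torsion_free_class \<A>c \<F>"
  shows tf_sub: "\<F> \<subseteq> \<A>"
    and tf_iso: "\<lbrakk>x \<in> \<F>; isomorphic T x y\<rbrakk> \<Longrightarrow> y \<in> \<F>"
    and tf_zero: "zero_object T z \<Longrightarrow> z \<in> \<F>"
    and tf_mono: "\<lbrakk>monic \<A>c m; Cod T m \<in> \<F>\<rbrakk> \<Longrightarrow> Dom T m \<in> \<F>"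
    and tf_ext: "\<lbrakk>triangle T x y z u v w; x \<in> \<F>; z \<in> \<F>\<rbrakk> \<Longrightarrow> y \<in> \<F>"
proof -
  have add: "additive_subcategory \<A>c \<F>" using assms by (simp add: torsion_free_class_def)
  then show sub: "\<F> \<subseteq> \<A>" by (simp add: additive_subcategory_def)
  show "y \<in> \<F>" if x: "x \<in> \<F>" "isomorphic T x y"
  proof -
    have A: "x \<in> \<A>" "y \<in> \<A>" using x sub A_iso by blast+
    have i: "isomorphic \<A>c x y" unfolding isomorphic_full_subcat using x A by blast
    have "\<forall>x \<in> \<F>. \<forall>y \<in> \<A>. isomorphic \<A>c x y \<longrightarrow> y \<in> \<F>"
      using add unfolding additive_subcategory_def full_subcat_simps by (elim conjE)
    from this[rule_format, OF x(1) A(2) i] show ?thesis .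
  qed
  show "z \<in> \<F>" if "zero_object T z"
  proof -
    have "zero_object \<A>c z" using that A_zero[OF that] unfolding zero_object_iff ab.zero_object_iff by simp
    then show ?thesis using add unfolding additive_subcategory_def by blast
  qed
  show "Dom T m \<in> \<F>" if "monic \<A>c m" "Cod T m \<in> \<F>"
    using assms that unfolding torsion_free_class_def full_subcat_simps by blast
  show "y \<in> \<F>" if tr: "triangle T x y z u v w" and x: "x \<in> \<F>" "z \<in> \<F>"
  proof -
    have A: "x \<in> \<A>" "z \<in> \<A>" using x sub by auto
    \<comment> \<open>Extension closure puts the middle vertex in \<A>, so that the triangle
      corresponds to a short exact sequence there.\<close>
    then have y: "y \<in> \<A>" using ext_closed triangle_star[OF tr] unfolding extension_closed_def by blast
    have "short_exact \<A>c u v" by (rule triangle_short_exact[OF tr A(1) y A(2)])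
    then show ?thesis
      using assms x HomD[OF triangleD(1)[OF tr]] HomD[OF triangleD(2)[OF tr]]
      unfolding torsion_free_class_def full_subcat_simps by blast
  qed
qed

lemma tf_obj: "torsion_free_class \<A>c \<F> \<Longrightarrow> \<F> \<subseteq> Obj T"
  using tf_sub A_obj by blast

lemma tf_swap:
  assumes tf: "torsion_free_class \<A>c \<F>"
  shows "star T \<A> (susp T \<F>) \<subseteq> star T (susp T \<F>) \<A>"
proof
  fix z assume "z \<in> star T \<A> (susp T \<F>)"
  then obtain a s u v w where a: "a \<in> \<A>" and s: "s \<in> susp T \<F>" and tr: "triangle T a z s u v w" by (rule starE)
  obtain f where f: "f \<in> \<F>" "isomorphic T s (SObj T f)" using s unfolding susp_def by blast
  have fA: "f \<in> \<A>" and fo: "f \<in> Obj T" using f tf_sub[OF tf] A_obj by auto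
  note D = triangleD[OF tr]
  obtain u' v' w' where "triangle T a z (SObj T f) u' v' w'"
    by (rule triangle_isomorphic[OF tr isomorphic_refl[OF D(4)] isomorphic_refl[OF D(5)] f(2)])
  \<comment> \<open>Rotating back exhibits \<open>z\<close> as the cone of a map
    \<open>f \<rightarrow> a\<close> in \<A>.\<close>
  then obtain g where "triangle T f a z g u' v'" using triangle_unrotate[OF _ fo] by metis
  then obtain k m where k: "z \<in> star T (susp T {k}) \<A>" and m: "monic \<A>c m" "Dom T m = k" "Cod T m = f"
    using cone_in_susp_kernel_star[OF _ fA a] by metis
  have "k \<in> \<F>" using tf_mono[OF tf m(1)] m(2,3) f(1) by simp
  then have "star T (susp T {k}) \<A> \<subseteq> star T (susp T \<F>) \<A>" by (intro star_mono susp_mono) auto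
  then show "z \<in> star T (susp T \<F>) \<A>" using k by blast
qed

lemma tf_star_retract:
  assumes tf: "torsion_free_class \<A>c \<F>" and c: "c \<in> star T (susp T \<F>) \<A>" and re: "retract T d c"
  shows "d \<in> star T (susp T \<F>) \<A>"
proof -
  obtain f a u v w where f: "f \<in> \<F>" and a: "a \<in> \<A>" and tr: "triangle T (SObj T f) c a u v w"
    by (rule star_suspE[OF c tf_obj[OF tf]])
  note D = triangleD[OF tr]
  have fA: "f \<in> \<A>" and fo: "f \<in> Obj T" using f tf_sub[OF tf] A_obj by auto
  obtain i p where i: "i \<in> Hom T d c" and p: "p \<in> Hom T c d" and pi: "p \<cdot> i = Id T d"
    using re unfolding retract_def by blast
  have Sf: "SObj T f \<in> susp T \<A>" using SObj_in_susp fA fo by blast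
  note ip = comp_in_Hom[OF p i]
  have idem: "(i \<cdot> p) \<cdot> (i \<cdot> p) = i \<cdot> p"
    using comp_assoc[OF ip p i] comp_assoc[OF p i p] pi comp_id_left[OF p] by simp
  obtain e where e: "e \<in> Hom T (SObj T f) (SObj T f)" "u \<cdot> e = (i \<cdot> p) \<cdot> u"
    by (rule triangle_lift[OF tr a Sf comp_in_Hom[OF D(1) ip]])
  obtain \<epsilon> where \<epsilon>: "\<epsilon> \<in> Hom T f f" "SArr T \<epsilon> = e" using susp_full[OF fo fo e(1)] by blast
  \<comment> \<open>Both \<open>e \<cdot> e\<close> and \<open>e\<close> lift
    \<open>(i \<cdot> p) \<cdot> u\<close>, so they agree by uniqueness of lifts.\<close>
  have "u \<cdot> (e \<cdot> e) = u \<cdot> e"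
    using comp_assoc[OF e(1) e(1) D(1)] e(2) comp_assoc[OF e(1) D(1) ip] comp_assoc[OF D(1) ip ip] idem by simp
  then have ee: "e \<cdot> e = e" by (rule triangle_lift_unique[OF tr a Sf comp_in_Hom[OF e(1) e(1)] e(1)])
  have "SArr T (\<epsilon> \<cdot> \<epsilon>) = SArr T \<epsilon>" using susp_comp[OF \<epsilon>(1) \<epsilon>(1)] \<epsilon>(2) ee by simp
  then have \<epsilon>i: "\<epsilon> \<cdot> \<epsilon> = \<epsilon>" by (rule susp_inj[OF comp_in_Hom[OF \<epsilon>(1) \<epsilon>(1)] \<epsilon>(1)])
  have \<epsilon>A: "\<epsilon> \<in> Hom \<A>c f f" using \<epsilon>(1) fA by (simp add: Hom_full_subcat)
  obtain g m q where mA: "m \<in> Hom \<A>c g f" and qA: "q \<in> Hom \<A>c f g" and mq: "m \<cdot> q = \<epsilon>"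
    and qm: "q \<cdot> m = Id T g" and mm: "monic \<A>c m"
    by (rule ab.idempotent_splits[unfolded full_subcat_simps, OF \<epsilon>A \<epsilon>i])
  have m: "m \<in> Hom T g f" and q: "q \<in> Hom T f g" and gA: "g \<in> \<A>" using mA qA by (auto simp: Hom_full_subcat)
  have go: "g \<in> Obj T" using gA A_obj by blast
  have gF: "g \<in> \<F>" using tf_mono[OF tf mm] HomD[OF m] f by simp
  note Sm = susp_in[OF m] and Sq = susp_in[OF q]
  note um = comp_in_Hom[OF Sm D(1)]
  \<comment> \<open>Here \<open>\<Sigma>g\<close> is the image of \<open>e\<close>;
    \<open>\<psi>\<close> restricts \<open>u\<close> to it and projects to \<open>d\<close>. Its
    cone \<open>y\<close> will turn out to be a retract of \<open>a\<close>.\<close>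
  define \<psi> where "\<psi> = p \<cdot> (u \<cdot> SArr T m)"
  have \<psi>: "\<psi> \<in> Hom T (SObj T g) d" unfolding \<psi>_def by (rule comp_in_Hom[OF um p])
  obtain y v' w' where tr': "triangle T (SObj T g) d y \<psi> v' w'" using TR1_ex[OF \<psi>] by blast
  have qmS: "SArr T q \<cdot> SArr T m = Id T (SObj T g)" using susp_comp[OF m q] qm susp_id[OF go] by simp
  have mqS: "SArr T m \<cdot> SArr T q = e" using susp_comp[OF q m] mq \<epsilon>(2) by simp
  have em: "e \<cdot> SArr T m = SArr T m"
    using mqS comp_assoc[OF Sm Sq Sm] qmS comp_id_right[OF Sm] by simp
  have pe: "(p \<cdot> i) \<cdot> p = p" using pi comp_id_left[OF p] by simp
  \<comment> \<open>This square and the next are the input of \<open>triangle_retract\<close>: the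
    inclusions \<open>SArr T m\<close>, \<open>i\<close> and the retractions
    \<open>SArr T q\<close>, \<open>p\<close> commute with \<open>\<psi>\<close> and
    \<open>u\<close>.\<close>
  have 1: "i \<cdot> \<psi> = u \<cdot> SArr T m"
  proof -
    have "i \<cdot> \<psi> = ((i \<cdot> p) \<cdot> u) \<cdot> SArr T m"
      unfolding \<psi>_def using comp_assoc[OF um p i] comp_assoc[OF Sm D(1) ip] by simp
    also have "\<dots> = u \<cdot> (e \<cdot> SArr T m)" using e(2) comp_assoc[OF Sm e(1) D(1)] by simp
    finally show ?thesis using em by simp
  qed
  have 2: "p \<cdot> u = \<psi> \<cdot> SArr T q"
  proof -
    have "\<psi> \<cdot> SArr T q = p \<cdot> (u \<cdot> e)"
      unfolding \<psi>_def using comp_assoc[OF Sq um p] comp_assoc[OF Sq Sm D(1)] mqS by simp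
    also have "\<dots> = (p \<cdot> (i \<cdot> p)) \<cdot> u" using e(2) comp_assoc[OF D(1) ip p] by simp
    also have "\<dots> = p \<cdot> u" using comp_assoc[OF p i p] pe by simp
    finally show ?thesis by simp
  qed
  have "retract T y a" by (rule triangle_retract[OF tr' tr Sm Sq qmS i p pi 1 2])
  then have y: "y \<in> \<A>" using A_retract a by blast
  show ?thesis by (rule triangle_star[OF tr' SObj_in_susp[OF gF go] y])
qed

text \<open>Uses the triangle \<open>\<Sigma>n \<rightarrow> a = a\<close> with \<open>n\<close> a
  zero object.\<close>

lemma A_in_star:
  assumes "a \<in> \<A>" and z: "\<And>n. zero_object T n \<Longrightarrow> n \<in> \<F>"
  shows "a \<in> star T (susp T \<F>) \<A>"
proof -
  obtain n where n: "zero_object T n" using ex_zero_object by blast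
  then have no: "n \<in> Obj T" and Sn: "zero_object T (SObj T n)"
    using zero_object_susp by (auto simp: zero_object_def)
  have "a \<in> Obj T" using assms A_obj by blast
  from triangle_star[OF triangle_zero_id[OF this Sn] SObj_in_susp[OF z[OF n] no] assms(1)]
  show ?thesis .
qed

text \<open>Write \<open>S\<close> for \<open>\<Sigma>\<F>\<close>. In
  \<open>S * \<A> * S * \<A>\<close> the two inner factors are interchanged by
  \<open>tf_swap\<close>; after regrouping, \<open>S * S\<close> and \<open>\<A> * \<A>\<close>
  collapse by extension closure of \<F> and \<A>.\<close>

lemma tf_star_extension_closed:
  assumes tf: "torsion_free_class \<A>c \<F>"
  shows "extension_closed T (star T (susp T \<F>) \<A>)"
proof -
  let ?S = "susp T \<F>"
  have "star T \<F> \<F> \<subseteq> \<F>" using tf_ext[OF tf] unfolding star_def by blast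
  then have SS: "star T ?S ?S \<subseteq> ?S" using susp_star_susp[OF tf_obj[OF tf]] susp_mono by blast
  have AA: "star T \<A> \<A> \<subseteq> \<A>" using ext_closed by (simp add: extension_closed_def)
  have "star T (star T ?S \<A>) (star T ?S \<A>) = star T ?S (star T (star T \<A> ?S) \<A>)"
    by (simp add: star_assoc)
  also have "\<dots> \<subseteq> star T ?S (star T (star T ?S \<A>) \<A>)"
    by (rule star_mono[OF order_refl star_mono[OF tf_swap[OF tf] order_refl]])
  also have "\<dots> = star T (star T ?S ?S) (star T \<A> \<A>)" by (simp add: star_assoc)
  also have "\<dots> \<subseteq> star T ?S \<A>" using SS AA by (rule star_mono)
  finally show ?thesis by (simp add: extension_closed_def)
qed

lemma tf_star_intermediate:
  assumes tf: "torsion_free_class \<A>c \<F>"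
  shows "intermediate T \<A> (star T (susp T \<F>) \<A>)"
proof -
  have "summand_closed T (star T (susp T \<F>) \<A>)"
    unfolding summand_closed_def using tf_star_retract[OF tf] direct_sum_retract by metis
  moreover have "star T (susp T \<F>) \<A> \<subseteq> star T (susp T \<A>) \<A>"
    using tf_sub[OF tf] by (intro star_mono susp_mono) auto
  ultimately show ?thesis
    unfolding intermediate_def using A_in_star tf_zero[OF tf] tf_star_extension_closed[OF tf] by blast
qed

section \<open>From intermediate categories to torsion-free classes\<close>

lemma susp_in_intermediate:
  assumes C: "intermediate T \<A> \<C>" and tr: "triangle T (SObj T f) c a u v w"
    and f: "f \<in> \<A>" and a: "a \<in> \<A>" and cC: "c \<in> \<C>" and c: "c \<in> star T \<A> (susp T \<A>)"
  shows "SObj T f \<in> \<C>"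
proof -
  note D = triangleD[OF tr]
  obtain a' s r h k where a': "a' \<in> \<A>" and s: "s \<in> susp T \<A>" and tr': "triangle T a' c s r h k"
    by (rule starE[OF c])
  note D' = triangleD[OF tr']
  define g where "g = v \<cdot> r"
  have g: "g \<in> Hom T a' a" unfolding g_def by (rule comp_in_Hom[OF D'(1) D(2)])
  have gA: "g \<in> Hom \<A>c a' a" using g a a' by (simp add: Hom_full_subcat)
  \<comment> \<open>Follows from \<open>w \<cdot> v = 0\<close>; it will kill the connecting map of
    the extension \<open>y\<close> built below.\<close>
  have wg: "w \<cdot> g = Zer T a' (SObj T (SObj T f))"
    unfolding g_def using comp_assoc[OF D'(1) D(2,3)] triangle_comp_zero[OF triangle_rotate[OF tr]]
      zer_comp[OF D'(1) susp_obj[OF D(4)]] by simp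
  have Sf: "SObj T f \<in> susp T \<A>" using SObj_in_susp f A_obj by blast
  \<comment> \<open>If \<open>t \<cdot> g = 0\<close>, then \<open>t \<cdot> v\<close> factors
    through \<open>s\<close> in \<open>\<Sigma>\<A>\<close>, which has no nonzero map to
    \<open>b\<close>. So \<open>t \<cdot> v = 0\<close>, and \<open>t\<close> factors through
    \<open>\<Sigma>\<Sigma>f\<close>, which has none either.\<close>
  have epi: "t = Zer T a b" if t: "t \<in> Hom T a b" and b: "b \<in> \<A>" and tg: "t \<cdot> g = Zer T a' b" for t b
  proof -
    have bo: "b \<in> Obj T" using b A_obj by blast
    note tv = comp_in_Hom[OF D(2) t]
    have "(t \<cdot> v) \<cdot> r = Zer T a' b" using tg comp_assoc[OF D'(1) D(2) t] by (simp add: g_def)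
    then obtain l where l: "l \<in> Hom T s b" "l \<cdot> h = t \<cdot> v" by (rule triangle_coexact[OF tr' tv])
    then have "l = Zer T s b" using Hom_susp_A(1)[OF s b] by blast
    then have "t \<cdot> v = Zer T c b" using l(2) zer_comp[OF D'(2) bo] by simp
    then obtain n where n: "n \<in> Hom T (SObj T (SObj T f)) b" "n \<cdot> w = t"
      by (rule triangle_coexact[OF triangle_rotate[OF tr] t])
    then have "n = Zer T (SObj T (SObj T f)) b" using Hom_susp_A(2)[OF Sf b] by blast
    then show ?thesis using n(2) zer_comp[OF D(3) bo] by simp
  qed
  have "epic \<A>c g"
    unfolding epic_def
  proof (intro conjI allI ballI impI)
    show "g \<in> Arr \<A>c" using HomD[OF gA] by simp
    fix b s t assume "s \<in> Hom \<A>c (Cod \<A>c g) b" "t \<in> Hom \<A>c (Cod \<A>c g) b" and e: "s \<cdot>\<^bsub>\<A>c\<^esub> g = t \<cdot>\<^bsub>\<A>c\<^esub> g"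
    then have s: "s \<in> Hom T a b" and t: "t \<in> Hom T a b" and b: "b \<in> \<A>" and e: "s \<cdot> g = t \<cdot> g"
      using HomD[OF g] by (auto simp: Hom_full_subcat)
    have "Sub s t \<cdot> g = Zer T a' b" using sub_comp[OF g s t] e sub_self[OF comp_in_Hom[OF g t]] by simp
    from epi[OF sub_in[OF s t] b this] show "s = t" by (rule sub_eq_zer[OF s t])
  qed
  then obtain i where i: "i \<in> Hom \<A>c (Dom \<A>c i) (Dom \<A>c g)" "short_exact \<A>c i g" by (rule ab.epic_short_exact)
  define x where "x = Dom T i"
  have iA: "i \<in> Hom \<A>c x a'" using i(1) HomD[OF g] by (simp add: x_def)
  then have x: "x \<in> \<A>" "x \<in> Obj T" using A_obj by (auto simp: Hom_full_subcat)
  obtain \<gamma> where 1: "triangle T x a' a i g \<gamma>" by (rule short_exact_triangle[OF i(2) iA gA])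
  note D1 = triangleD[OF 1]
  \<comment> \<open>The fibre \<open>y\<close> of \<open>\<gamma> \<cdot> v\<close> is an extension
    of \<open>c\<close> by \<open>x\<close>, and both of these lie in \<C>.\<close>
  obtain y l m where 2: "triangle T x y c l m (\<gamma> \<cdot> v)" by (rule ex_extension[OF comp_in_Hom[OF D(2) D1(3)] x(2)])
  have "y \<in> star T \<C> \<C>" using triangle_star[OF 2] x(1) cC C unfolding intermediate_def by blast
  then have yC: "y \<in> \<C>" using C unfolding intermediate_def extension_closed_def by blast
  have 3: "triangle T c (SObj T x) (SObj T y) (\<gamma> \<cdot> v) (Neg T (SArr T l)) (Neg T (SArr T m))"
    by (rule triangle_rotate[OF triangle_rotate[OF 2]])
  note Si = susp_in[OF D1(1)] and Sg = susp_in[OF g]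
  have 4: "triangle T a (SObj T x) (SObj T a') \<gamma> (Neg T (SArr T i)) (Neg T (SArr T g))"
    by (rule triangle_rotate[OF triangle_rotate[OF 1]])
  note o = susp_obj[OF D'(4)] susp_obj[OF D(4)] susp_obj[OF susp_obj[OF D(4)]]
  have "SArr T w \<cdot> SArr T g = Zer T (SObj T a') (SObj T (SObj T (SObj T f)))"
    using susp_comp[OF g D(3)] susp_zer[OF D'(4) o(2)] unfolding wg by simp
  then have "SArr T w \<cdot> Neg T (SArr T g) = Zer T (SObj T a') (SObj T (SObj T (SObj T f)))"
    using comp_neg[OF Sg susp_in[OF D(3)]] neg_zer[OF o(1) susp_obj[OF o(2)]] by simp
  \<comment> \<open>The octahedron on \<open>c \<rightarrow> a \<rightarrow> \<Sigma>x\<close> gives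
    the suspension of an extension \<open>\<Sigma>f \<rightarrow> y \<rightarrow> a'\<close>. Its
    connecting map is \<open>SArr T w \<cdot> Neg T (SArr T g) = 0\<close>, so it splits.\<close>
  with TR4[OF triangle_rotate[OF tr] 4 3]
  obtain p q where "triangle T (SObj T (SObj T f)) (SObj T y) (SObj T a') p q
     (Zer T (SObj T a') (SObj T (SObj T (SObj T f))))" by auto
  from retract_desusp[OF triangle_zero_split[OF this] D(4) triangleD(5)[OF 2]]
  show ?thesis using summand_closed_retract yC C unfolding intermediate_def by blast
qed

text \<open>Short exact sequences in \<A> become triangles, and extension closure of \<C> applies to
  their suspensions and rotations. When \<C> also lies in \<open>star T \<A> (susp T \<A>)\<close>,
  \<open>functor_image_intermediate\<close> identifies this set with \<open>F(\<C>)\<close>.\<close>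

lemma torsion_free_of_intermediate:
  assumes C: "intermediate T \<A> \<C>"
  shows "torsion_free_class \<A>c {a \<in> \<A>. SObj T a \<in> \<C>}"
proof -
  let ?F = "{a \<in> \<A>. SObj T a \<in> \<C>}"
  have AC: "\<A> \<subseteq> \<C>" and ext: "star T \<C> \<C> \<subseteq> \<C>" and sc: "summand_closed T \<C>"
    using C unfolding intermediate_def extension_closed_def by auto
  have re: "y \<in> ?F" if x: "x \<in> ?F" and r: "retract T y x" for x y
  proof -
    have "y \<in> \<A>" using A_retract x r by blast
    moreover then have "retract T (SObj T y) (SObj T x)" using retract_susp[OF r] A_obj by blast
    ultimately show ?thesis using x summand_closed_retract[OF sc] by blast
  qed
  have se: "b \<in> ?F" if ses: "short_exact \<A>c f g" "f \<in> Hom \<A>c a b" "g \<in> Hom \<A>c b c" "a \<in> ?F" "c \<in> ?F" for f g a b c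
  proof -
    obtain h where "triangle T a b c f g h" by (rule short_exact_triangle[OF ses(1-3)])
    then obtain u v w where "triangle T (SObj T a) (SObj T b) (SObj T c) u v w" by (rule triangle_susp)
    then have "SObj T b \<in> \<C>" using triangle_star[of _ "SObj T b"] ext ses(4,5) by blast
    then show ?thesis using ses(2) by (simp add: Hom_full_subcat)
  qed
  have FA: "?F \<subseteq> Obj \<A>c" by simp
  have "additive_subcategory \<A>c ?F"
    unfolding additive_subcategory_def
  proof (intro conjI ballI allI impI)
    fix x y assume x: "x \<in> ?F" and "isomorphic \<A>c x y"
    then have "isomorphic T x y" by (simp add: isomorphic_full_subcat)
    from re[OF x isomorphic_retract[OF isomorphic_sym[OF this]]] show "y \<in> ?F" .
  next
    fix z assume "zero_object \<A>c z"
    then have z: "z \<in> \<A>" "zero_object T z" using A_obj unfolding zero_object_iff ab.zero_object_iff by auto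
    then have "SObj T z \<in> \<A>" using A_zero zero_object_susp by blast
    then show "z \<in> ?F" using z AC by blast
  next
    fix x y z assume x: "x \<in> ?F" "y \<in> ?F" and z: "direct_sum \<A>c z x y"
    obtain i q where "i \<in> Hom \<A>c x z" "q \<in> Hom \<A>c z y" "short_exact \<A>c i q" by (rule ab.direct_sum_short_exact[OF z])
    then show "z \<in> ?F" using se x by blast
  next
    show "summand_closed \<A>c ?F"
      unfolding summand_closed_def direct_sum_full_subcat[OF A_obj]
    proof (intro ballI allI impI)
      fix z x y assume z: "z \<in> ?F" and "direct_sum T z x y \<and> x \<in> \<A> \<and> y \<in> \<A> \<and> z \<in> \<A>"
      then have r: "retract T x z" "retract T y z" using direct_sum_retract[of T z x y] by auto
      from re[OF z r(1)] re[OF z r(2)] show "x \<in> ?F \<and> y \<in> ?F" ..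
    qed
  qed (rule FA)
  moreover have "Cod T f \<in> ?F" if "short_exact \<A>c f g" "Dom T f \<in> ?F" "Cod T g \<in> ?F" for f g
  proof (rule se[OF that(1) _ _ that(2,3)])
    show "f \<in> Hom \<A>c (Dom T f) (Cod T f)" "g \<in> Hom \<A>c (Cod T f) (Cod T g)"
      using that(1) by (auto simp: short_exact_def is_kernel_def Hom_def)
  qed
  moreover have "Dom T m \<in> ?F" if m: "monic \<A>c m" and c: "Cod T m \<in> ?F" for m
  proof -
    obtain q where q: "q \<in> Hom \<A>c (Cod \<A>c m) (Cod \<A>c q)" "short_exact \<A>c m q"
      by (rule ab.monic_short_exact[OF m])
    have mH: "m \<in> Hom \<A>c (Dom T m) (Cod T m)" using m by (simp add: monic_def Hom_def)
    have "q \<in> Hom \<A>c (Cod T m) (Cod T q)" using q(1) by simp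
    then obtain h where "triangle T (Dom T m) (Cod T m) (Cod T q) m q h" by (rule short_exact_triangle[OF q(2) mH])
    \<comment> \<open>For \<open>m: x \<rightarrow> y\<close>, rotating twice gives
      \<open>coker m \<rightarrow> \<Sigma>x \<rightarrow> \<Sigma>y\<close>, whose outer terms lie
      in \<C>.\<close>
    from triangle_star[OF triangle_rotate[OF triangle_rotate[OF this]]]
    have "SObj T (Dom T m) \<in> star T \<C> \<C>" using q(1) c AC by (auto simp: Hom_full_subcat)
    then show ?thesis using ext mH by (auto simp: Hom_full_subcat)
  qed
  ultimately show ?thesis unfolding torsion_free_class_def full_subcat_simps by blast
qed

section \<open>The approximation functor and its images\<close>

context
  fixes Fo Fm \<phi>
  assumes F: "approximation_functor T \<A> Fo Fm \<phi>"
begin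

lemma Fo_in: "c \<in> star T (susp T \<A>) \<A> \<Longrightarrow> Fo c \<in> \<A>"
  using F unfolding approximation_functor_def is_functor_def by simp

lemma Fo_isomorphic:
  assumes tr: "triangle T (SObj T a) c y u v w" and a: "a \<in> \<A>" and y: "y \<in> \<A>"
  shows "isomorphic T a (Fo c)"
proof -
  have c: "c \<in> star T (susp T \<A>) \<A>" using triangle_star[OF tr SObj_in_susp y] a A_obj by blast
  then have "minimal_right_approximation T (susp T \<A>) c (SObj T (Fo c)) (\<phi> c)"
    using F unfolding approximation_functor_def by blast
  from approximation_isomorphic[OF tr a y this Fo_in[OF c]] show ?thesis .
qed

lemma Fo_susp:
  assumes a: "a \<in> \<A>" shows "isomorphic T a (Fo (SObj T a))"
proof -
  obtain n where n: "zero_object T n" using ex_zero_object by blast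
  have "SObj T a \<in> Obj T" using a A_obj susp_obj by blast
  \<comment> \<open>The triangle is \<open>\<Sigma>a = \<Sigma>a \<rightarrow> 0\<close>, whose last
    vertex lies in \<A> as a zero object.\<close>
  from Fo_isomorphic[OF TR1_id[OF this n] a A_zero[OF n]] show ?thesis .
qed

lemma functor_image_tf:
  assumes tf: "torsion_free_class \<A>c \<F>"
  shows "functor_image T \<A> Fo (star T (susp T \<F>) \<A>) = \<F>"
proof
  show "functor_image T \<A> Fo (star T (susp T \<F>) \<A>) \<subseteq> \<F>"
  proof
    fix a assume "a \<in> functor_image T \<A> Fo (star T (susp T \<F>) \<A>)"
    then obtain c where c: "c \<in> star T (susp T \<F>) \<A>" and ac: "isomorphic T a (Fo c)"
      unfolding functor_image_def by blast
    obtain f y u v w where f: "f \<in> \<F>" "y \<in> \<A>" "triangle T (SObj T f) c y u v w"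
      by (rule star_suspE[OF c tf_obj[OF tf]])
    have "isomorphic T f (Fo c)" using Fo_isomorphic f tf_sub[OF tf] by blast
    from tf_iso[OF tf f(1) isomorphic_trans[OF this isomorphic_sym[OF ac]]] show "a \<in> \<F>" .
  qed
  show "\<F> \<subseteq> functor_image T \<A> Fo (star T (susp T \<F>) \<A>)"
  proof
    fix f assume f: "f \<in> \<F>"
    then have fA: "f \<in> \<A>" and fo: "f \<in> Obj T" using tf_sub[OF tf] A_obj by auto
    obtain n where n: "zero_object T n" using ex_zero_object by blast
    from triangle_star[OF TR1_id[OF susp_obj[OF fo] n] SObj_in_susp[OF f fo] A_zero[OF n]]
    show "f \<in> functor_image T \<A> Fo (star T (susp T \<F>) \<A>)"
      unfolding functor_image_def using fA Fo_susp[OF fA] by blast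
  qed
qed

text \<open>If \<open>a \<cong> F(c)\<close>, then \<open>a \<cong> f\<close> for any triangle
  \<open>\<Sigma>f \<rightarrow> c \<rightarrow> y\<close> with \<open>f\<close>, \<open>y\<close>
  in \<A>, and \<open>susp_in_intermediate\<close> puts \<open>\<Sigma>f\<close> in \<C>. Conversely
  \<open>a \<cong> F(\<Sigma>a)\<close>.\<close>

lemma functor_image_intermediate:
  assumes C: "intermediate T \<A> \<C>" and sub: "\<C> \<subseteq> star T \<A> (susp T \<A>)"
  shows "functor_image T \<A> Fo \<C> = {a \<in> \<A>. SObj T a \<in> \<C>}"
proof -
  have CS: "\<C> \<subseteq> star T (susp T \<A>) \<A>" and sc: "summand_closed T \<C>"
    using C by (auto simp: intermediate_def)
  have "SObj T a \<in> \<C>" if a: "a \<in> \<A>" and c: "c \<in> \<C>" and ac: "isomorphic T a (Fo c)" for a c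
  proof -
    obtain f y u v w where f: "f \<in> \<A>" "y \<in> \<A>" and tr: "triangle T (SObj T f) c y u v w"
      by (rule star_suspE[OF subsetD[OF CS c] A_obj])
    have "isomorphic T f (Fo c)" using Fo_isomorphic[OF tr f] .
    from isomorphic_susp[OF isomorphic_trans[OF ac isomorphic_sym[OF this]]]
    have i: "isomorphic T (SObj T a) (SObj T f)" .
    have "SObj T f \<in> \<C>" by (rule susp_in_intermediate[OF C tr f c subsetD[OF sub c]])
    from summand_closed_retract[OF sc this isomorphic_retract[OF i]] show ?thesis .
  qed
  then show ?thesis unfolding functor_image_def using Fo_susp by blast
qed

text \<open>With the image rewritten as the \<open>a\<close> with \<open>\<Sigma>a\<close> in \<C>,
  one inclusion is \<open>susp_in_intermediate\<close> applied to a triangle for each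
  \<open>c\<close>; the other is extension closure, since both star factors lie in \<C>.\<close>

lemma intermediate_eq_star:
  assumes C: "intermediate T \<A> \<C>" and sub: "\<C> \<subseteq> star T \<A> (susp T \<A>)"
  shows "\<C> = star T (susp T (functor_image T \<A> Fo \<C>)) \<A>"
  unfolding functor_image_intermediate[OF C sub]
proof
  let ?F = "{a \<in> \<A>. SObj T a \<in> \<C>}"
  have CS: "\<C> \<subseteq> star T (susp T \<A>) \<A>" and sc: "summand_closed T \<C>" and AC: "\<A> \<subseteq> \<C>" and ext: "star T \<C> \<C> \<subseteq> \<C>"
    using C by (auto simp: intermediate_def extension_closed_def)
  show "\<C> \<subseteq> star T (susp T ?F) \<A>"
  proof
    fix c assume c: "c \<in> \<C>"
    obtain f y u v w where f: "f \<in> \<A>" "y \<in> \<A>" and tr: "triangle T (SObj T f) c y u v w"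
      by (rule star_suspE[OF subsetD[OF CS c] A_obj])
    have "SObj T f \<in> \<C>" by (rule susp_in_intermediate[OF C tr f c subsetD[OF sub c]])
    then have "SObj T f \<in> susp T ?F" using SObj_in_susp[of f ?F] f A_obj by blast
    then show "c \<in> star T (susp T ?F) \<A>" using triangle_star[OF tr] f(2) by blast
  qed
  have "susp T ?F \<subseteq> \<C>"
    using summand_closed_retract[OF sc _ isomorphic_retract] by (auto simp: susp_def)
  then have "star T (susp T ?F) \<A> \<subseteq> star T \<C> \<C>" using AC by (rule star_mono)
  then show "star T (susp T ?F) \<A> \<subseteq> \<C>" using ext by blast
qed

end

end

theorem theoremB:
  fixes T :: "('o, 'm) tri_data" and \<A> :: "'o set"
    and Fo :: "'o \<Rightarrow> 'o" and Fm :: "'m \<Rightarrow> 'm" and \<phi> :: "'o \<Rightarrow> 'm"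
  assumes "triangulated_category T"
    and "proper_abelian_subcategory T \<A>"
    and "extension_closed T \<A>"
    and "krull_schmidt T"
    and "\<And>i. i \<in> {1, 2} \<Longrightarrow> Hom_vanishes T \<A> (desusp T i \<A>)"
    and "approximation_functor T \<A> Fo Fm \<phi>"
  shows
    "(\<forall>\<F>. torsion_free_class (full_subcat T \<A>) \<F> \<longrightarrow>
        intermediate T \<A> (star T (susp T \<F>) \<A>) \<and>
        functor_image T \<A> Fo (star T (susp T \<F>) \<A>) = \<F>) \<and>
     (\<forall>\<C>. intermediate T \<A> \<C> \<and> \<C> \<subseteq> star T \<A> (susp T \<A>) \<longrightarrow>
        torsion_free_class (full_subcat T \<A>) (functor_image T \<A> Fo \<C>) \<and>
        \<C> = star T (susp T (functor_image T \<A> Fo \<C>)) \<A>) \<and>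
     (star T \<A> (susp T \<A>) = star T (susp T \<A>) \<A> \<longrightarrow>
        bij_betw (functor_image T \<A> Fo)
          {\<C>. intermediate T \<A> \<C>} {\<F>. torsion_free_class (full_subcat T \<A>) \<F>} \<and>
        (\<forall>\<F>. torsion_free_class (full_subcat T \<A>) \<F> \<longrightarrow>
           inv_into {\<C>. intermediate T \<A> \<C>} (functor_image T \<A> Fo) \<F>
             = star T (susp T \<F>) \<A>))"
proof -
  interpret proper_abelian_setting T \<A>
    using assms(1-3,5) by (simp add: proper_abelian_setting_def proper_abelian_setting_axioms_def)
  let ?F = "functor_image T \<A> Fo" and ?G = "\<lambda>\<F>. star T (susp T \<F>) \<A>"
  let ?I = "{\<C>. intermediate T \<A> \<C>}" and ?T = "{\<F>. torsion_free_class (full_subcat T \<A>) \<F>}"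
  have 1: "intermediate T \<A> (?G \<F>)" "?F (?G \<F>) = \<F>" if "torsion_free_class (full_subcat T \<A>) \<F>" for \<F>
    using tf_star_intermediate[OF that] functor_image_tf[OF assms(6) that] by auto
  have 2: "torsion_free_class (full_subcat T \<A>) (?F \<C>)" "\<C> = ?G (?F \<C>)"
    if C: "intermediate T \<A> \<C>" and sub: "\<C> \<subseteq> star T \<A> (susp T \<A>)" for \<C>
    using torsion_free_of_intermediate[OF C] functor_image_intermediate[OF assms(6) C sub]
      intermediate_eq_star[OF assms(6) C sub] by auto
  have 3: "bij_betw ?F ?I ?T" if eq: "star T \<A> (susp T \<A>) = star T (susp T \<A>) \<A>"
  proof -
    \<comment> \<open>Equality of the two star products makes the extra hypothesis of the second
      part hold for every intermediate category.\<close>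
    have sub: "\<C> \<subseteq> star T \<A> (susp T \<A>)" if "\<C> \<in> ?I" for \<C> using that eq by (simp add: intermediate_def)
    have inv: "?G (?F \<C>) = \<C>" if "\<C> \<in> ?I" for \<C> using 2(2)[of \<C>] sub[OF that] that by simp
    show ?thesis
    proof (rule bij_betw_byWitness[where f' = ?G])
      show "\<forall>\<C> \<in> ?I. ?G (?F \<C>) = \<C>" using inv by blast
      show "\<forall>\<F> \<in> ?T. ?F (?G \<F>) = \<F>" using 1(2) by blast
      show "?F ` ?I \<subseteq> ?T" using 2(1) sub by blast
      show "?G ` ?T \<subseteq> ?I" using 1(1) by blast
    qed
  qed
  \<comment> \<open>\<open>inv_into\<close> chooses some preimage; injectivity forces it to be
    \<open>?G \<F>\<close>, which is intermediate and is sent to \<F>.\<close>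
  have 4: "inv_into ?I ?F \<F> = ?G \<F>"
    if "star T \<A> (susp T \<A>) = star T (susp T \<A>) \<A>" "torsion_free_class (full_subcat T \<A>) \<F>" for \<F>
    using inv_into_f_f[OF bij_betw_imp_inj_on[OF 3[OF that(1)]], of "?G \<F>"] 1[OF that(2)] by simp
  show ?thesis
    by (intro conjI allI impI; (elim conjE)?)
      (rule 1 2 3 4; assumption)+
qed

end
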